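(* Let $0<\epsilon\le35$. Let $X_1,\ldots,X_n$ be i.i.d. with distribution $P^\star$, an arbitrary probability on $(E,\mathcal E)$. Let $\mathcal M$ be an at most countable set of probability densities with respect to $\mu$ and $\mathscr M=\{p\cdot\mu,\ p\in\mathcal M\}$. Assume that: (a) there is a constant $a_2'\ge0$ such that $\min\{P(p\le q),Q(p>q)\}\le a_2'\|P-Q\|$ for all $P=p\cdot\mu$, $Q=q\cdot\mu$ in $\mathscr M$, and set $a_2=1+a_2'$; (b) there is $V\ge1$ such that, for every $\overline p\in\mathcal M$, the classes of sets $\{\{\overline p<q\},\ q\in\mathcal M\setminus\{\overline p\}\}$ and $\{\{\overline p>q\},\ q\in\mathcal M\setminus\{\overline p\}\}$ are both VC with dimension not larger than $V$. Then any TV-estimator $\widehat P\in\mathscr M$ satisfies, for all $\xi>0$, with probability at least $1-e^{-\xi}$, $$\|P^\star-\widehat P\|\le14\inf_{P\in\overline{\mathscr M}}\|P^\star-P\|+\frac{144a_2}{n}\left[c\,a_2^2V\log\left(\frac{2en}{V\wedge n}\right)+1+\xi\right],$$ where $c$ is a positive numerical constant ($c=4.5\times10^5$ suits).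
   Context: $(E,\mathcal E)$ is a measurable space with a $\sigma$-finite measure $\mu$. $\|P-Q\|=\sup_{A\in\mathcal E}[P(A)-Q(A)]$ is the total variation distance between probabilities. $\overline{\mathscr M}$ is the set of probabilities $P$ on $(E,\mathcal E)$ with $\inf_{Q\in\mathscr M}\|P-Q\|=0$. $V\wedge n=\min\{V,n\}$. $\{p>q\}=\{x\in E:\ p(x)>q(x)\}$, etc. TV-estimator: for $P=p\cdot\mu,Q=q\cdot\mu\in\mathscr M$ let $$t_{(P,Q)}=\tfrac12\left[1_{q>p}-Q(q>p)\right]-\tfrac12\left[1_{p>q}-P(p>q)\right],\qquad\mathbf T(\boldsymbol X,P)=\sup_{Q\in\mathscr M}\sum_{i=1}^nt_{(P,Q)}(X_i).$$ A TV-estimator (with parameter $\epsilon>0$) is any measurable random element $\widehat P$ of $\mathscr M$ with $\mathbf T(\boldsymbol X,\widehat P)\le\inf_{P\in\mathscr M}\mathbf T(\boldsymbol X,P)+\epsilon$. *)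

theory Defs
  imports "HOL-Probability.Probability" "HOL-Library.Extended_Nat"
begin

definition tv_dist :: "'a measure \<Rightarrow> 'a measure \<Rightarrow> real" where
  "tv_dist P Q = (SUP A\<in>sets P. measure P A - measure Q A)"

definition prob_densities :: "'a measure \<Rightarrow> ('a \<Rightarrow> real) set" where
  "prob_densities \<mu> =
     {p \<in> borel_measurable \<mu>. (\<forall>x\<in>space \<mu>. 0 \<le> p x) \<and> (\<integral>\<^sup>+ x. ennreal (p x) \<partial>\<mu>) = 1}"

definition prob_of :: "'a measure \<Rightarrow> ('a \<Rightarrow> real) \<Rightarrow> 'a measure" where
  "prob_of \<mu> p = density \<mu> (\<lambda>x. ennreal (p x))"

definition model :: "'a measure \<Rightarrow> ('a \<Rightarrow> real) set \<Rightarrow> 'a measure set" where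
  "model \<mu> \<M> = prob_of \<mu> ` \<M>"

definition tv_closure :: "'a measure \<Rightarrow> 'a measure set \<Rightarrow> 'a measure set" where
  "tv_closure \<mu> \<P> =
     {P. prob_space P \<and> sets P = sets \<mu> \<and> (INF Q\<in>\<P>. tv_dist P Q) = 0}"

definition gt_set :: "'a measure \<Rightarrow> ('a \<Rightarrow> real) \<Rightarrow> ('a \<Rightarrow> real) \<Rightarrow> 'a set" where
  "gt_set \<mu> p q = {x \<in> space \<mu>. p x > q x}"

definition le_set :: "'a measure \<Rightarrow> ('a \<Rightarrow> real) \<Rightarrow> ('a \<Rightarrow> real) \<Rightarrow> 'a set" where
  "le_set \<mu> p q = {x \<in> space \<mu>. p x \<le> q x}"

definition shatters :: "'a set set \<Rightarrow> 'a set \<Rightarrow> bool" where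
  "shatters \<C> S \<longleftrightarrow> (\<lambda>A. S \<inter> A) ` \<C> = Pow S"

text \<open>
  A class is VC iff its dimension is finite, so a bound of the form
  \<open>vc_dim \<C> \<le> enat V\<close> includes the assertion that \<open>\<C>\<close> is VC.
  The empty class gets dimension 0.
\<close>
definition vc_dim :: "'a set set \<Rightarrow> enat" where
  "vc_dim \<C> = (SUP S\<in>{S. finite S \<and> shatters \<C> S}. enat (card S))"

text \<open>
  The test function and the statistic depend on the chosen versions of the densities, so they
  take densities as arguments rather than measures.
\<close>
definition tv_test :: "'a measure \<Rightarrow> ('a \<Rightarrow> real) \<Rightarrow> ('a \<Rightarrow> real) \<Rightarrow> 'a \<Rightarrow> real" where
  "tv_test \<mu> p q x =
     1/2 * (indicator (gt_set \<mu> q p) x - measure (prob_of \<mu> q) (gt_set \<mu> q p))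
   - 1/2 * (indicator (gt_set \<mu> p q) x - measure (prob_of \<mu> p) (gt_set \<mu> p q))"

definition tv_stat ::
  "'a measure \<Rightarrow> ('a \<Rightarrow> real) set \<Rightarrow> nat \<Rightarrow> (nat \<Rightarrow> 'a) \<Rightarrow> ('a \<Rightarrow> real) \<Rightarrow> real" where
  "tv_stat \<mu> \<M> n x p = (SUP q\<in>\<M>. \<Sum>i=1..n. tv_test \<mu> p q (x i))"

text \<open>
  For countable \<open>\<M>\<close> the trace on \<open>model \<mu> \<M>\<close> of the \<open>\<sigma>\<close>-algebra of \<open>prob_algebra \<mu>\<close> is
  discrete: it separates the points of a countable set. Hence \<open>count_space\<close> is the only natural
  choice here. When every element of the model has a single density in \<open>\<M>\<close>, the density \<open>p\<close>
  below is determined by \<open>Phat \<omega>\<close>; otherwise any representative in \<open>\<M>\<close> is allowed.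
\<close>
definition tv_estimator ::
  "'w measure \<Rightarrow> 'a measure \<Rightarrow> ('a \<Rightarrow> real) set \<Rightarrow> nat \<Rightarrow> (nat \<Rightarrow> 'w \<Rightarrow> 'a) \<Rightarrow> real
    \<Rightarrow> ('w \<Rightarrow> 'a measure) \<Rightarrow> bool" where
  "tv_estimator \<Omega> \<mu> \<M> n X \<epsilon> Phat \<longleftrightarrow>
     Phat \<in> measurable \<Omega> (count_space (model \<mu> \<M>)) \<and>
     (\<forall>\<omega>\<in>space \<Omega>. \<exists>p\<in>\<M>. Phat \<omega> = prob_of \<mu> p \<and>
        tv_stat \<mu> \<M> n (\<lambda>i. X i \<omega>) p \<le> (INF p'\<in>\<M>. tv_stat \<mu> \<M> n (\<lambda>i. X i \<omega>) p') + \<epsilon>)"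

end

theory Submission
  imports Defs
begin

text \<open>
Write \<open>S\<close> for the law of the data, \<open>D q\<close> for the distance from \<open>S\<close> to \<open>q \<cdot> \<mu>\<close>, and fix a
density \<open>r\<close> in the model that nearly minimises \<open>D\<close>.

The test \<open>t\<^sub>r\<^sub>q\<close> is antisymmetric in \<open>r\<close> and \<open>q\<close>, and its mean under \<open>S\<close> is at most
\<open>D r - 1/2 \<parallel>r - q\<parallel>\<close>. Suppose that, uniformly in \<open>q\<close>, the sum of the tests over the sample differs
from its mean by at most \<open>n/4 (D r + D q) + \<kappa>\<close>. If \<open>p\<close> is the density chosen by the estimator, then
\<open>\<Sum>t\<^sub>p\<^sub>r\<close> is at most \<open>sup\<^sub>q \<Sum>t\<^sub>r\<^sub>q + \<epsilon>\<close>; comparing the lower bound for the left side with the upper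
bound for the right side gives \<open>D p \<le> 13 D r + (8\<kappa> + 4\<epsilon>)/n\<close> (lemma \<open>tv_estimator_loss_le\<close>).

So everything rests on a deviation bound that is proportional to \<open>D r + D q\<close> up to a term of order
\<open>1/n\<close>, rather than of order \<open>1/\<surd>n\<close>. The test is a combination of the indicators of \<open>{q > r}\<close> and
\<open>{r > q}\<close>. Deviations of empirical frequencies are small relative to the probability of the set,
and those of a set and of its complement agree up to sign, so what matters is the smaller of the
two probabilities. The bound on \<open>min {P(p \<le> q), Q(p > q)}\<close> in the model implies that for the two sets
together this quantity is at most \<open>2 a\<^sub>2 (D r + D q)\<close> (lemma \<open>add_measures_le_of_min_le\<close>).

The relative deviation bound (lemma \<open>uniform_relative_deviation\<close>) is a Vapnik-Chervonenkis bound.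
Adding a ghost sample and averaging over all exchanges of the two samples, one only has to sum over
the traces of the class on \<open>2n\<close> points; if \<open>e\<^sup>\<alpha> + e\<^sup>\<beta> \<le> 2\<close>, each trace contributes at most \<open>1\<close> to the
exponential moment of \<open>\<alpha> n S(A) + \<beta> \<Sum>1\<^sub>A(X\<^sub>i)\<close>. The number of traces is bounded by the
Sauer-Shelah lemma.
\<close>

section \<open>The Sauer-Shelah lemma\<close>

text \<open>
Pajor's form of the Sauer-Shelah lemma. Remove a point \<open>w\<close> of the ground set. The family splits into
the traces \<open>\<F>0\<close> on the remaining points and the family \<open>\<F>1\<close> of those traces that come from two
members, one with \<open>w\<close> and one without. A set \<open>S\<close> shattered by \<open>\<F>0\<close> is shattered by \<open>\<F>\<close>, and if \<open>\<F>1\<close>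
shatters \<open>S\<close> then \<open>\<F>\<close> shatters \<open>insert w S\<close>; the shattered sets obtained in these two ways are
distinct, since only the latter contain \<open>w\<close>.
\<close>

lemma card_le_card_shattered:
  assumes "finite W" and "\<F> \<subseteq> Pow W"
  shows "card \<F> \<le> card {S. S \<subseteq> W \<and> shatters \<F> S}"
  using assms
proof (induction W arbitrary: \<F> rule: finite_induct)
  case empty
  then consider "\<F> = {}" | "\<F> = {{}}" by (auto simp: subset_singleton_iff)
  then show ?case
  proof cases
    case 2
    have "{S. S \<subseteq> {} \<and> shatters \<F> S} = {{} :: 'a set}"
      by (auto simp: shatters_def 2)
    then show ?thesis by (simp add: 2)
  qed simp
next
  case (insert w W)
  define \<F>0 where "\<F>0 = (\<lambda>A. A - {w}) ` \<F>"
  define \<F>1 where "\<F>1 = {A. w \<notin> A \<and> A \<in> \<F> \<and> insert w A \<in> \<F>}"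
  define Sh where "Sh \<G> = {S. S \<subseteq> W \<and> shatters \<G> S}" for \<G>
  have fin: "finite \<F>" "finite (Pow W)"
    using insert by (auto intro: finite_subset)
  have sub: "\<F>0 \<subseteq> Pow W" "\<F>1 \<subseteq> Pow W"
    using insert by (auto simp: \<F>0_def \<F>1_def)
  have finS: "finite (Sh \<G>)" for \<G>
    by (rule finite_subset[OF _ fin(2)]) (auto simp: Sh_def)
  have "card \<F> = card {A\<in>\<F>. w \<notin> A} + card {A\<in>\<F>. w \<in> A}"
    using fin by (subst card_Un_disjoint[symmetric]) (auto intro!: arg_cong[where f=card])
  also have "card {A\<in>\<F>. w \<in> A} = card ((\<lambda>A. A - {w}) ` {A\<in>\<F>. w \<in> A})"
    by (rule card_image[symmetric]) (auto simp: inj_on_def)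
  also have "card {A\<in>\<F>. w \<notin> A} + \<dots> =
      card ({A\<in>\<F>. w \<notin> A} \<union> (\<lambda>A. A - {w}) ` {A\<in>\<F>. w \<in> A})
      + card ({A\<in>\<F>. w \<notin> A} \<inter> (\<lambda>A. A - {w}) ` {A\<in>\<F>. w \<in> A})"
    using fin by (intro card_Un_Int) auto
  also have "{A\<in>\<F>. w \<notin> A} \<union> (\<lambda>A. A - {w}) ` {A\<in>\<F>. w \<in> A} = \<F>0"
  proof -
    have "{A\<in>\<F>. w \<notin> A} = (\<lambda>A. A - {w}) ` {A\<in>\<F>. w \<notin> A}"
      by (simp cong: image_cong_simp)
    then show ?thesis unfolding \<F>0_def by blast
  qed
  also have "{A\<in>\<F>. w \<notin> A} \<inter> (\<lambda>A. A - {w}) ` {A\<in>\<F>. w \<in> A} = \<F>1"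
  proof (intro equalityI subsetI)
    fix B assume "B \<in> {A\<in>\<F>. w \<notin> A} \<inter> (\<lambda>A. A - {w}) ` {A\<in>\<F>. w \<in> A}"
    then obtain A where "B \<in> \<F>" "w \<notin> B" "A \<in> \<F>" "w \<in> A" "B = A - {w}" by blast
    then show "B \<in> \<F>1" by (simp add: \<F>1_def insert_absorb)
  next
    fix B assume "B \<in> \<F>1"
    then have "B \<in> \<F>" "w \<notin> B" "insert w B \<in> \<F>" "B = insert w B - {w}" by (auto simp: \<F>1_def)
    then show "B \<in> {A\<in>\<F>. w \<notin> A} \<inter> (\<lambda>A. A - {w}) ` {A\<in>\<F>. w \<in> A}" by blast
  qed
  also have "card \<F>0 + card \<F>1 \<le> card (Sh \<F>0) + card (insert w ` Sh \<F>1)"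
  proof -
    have "card (insert w ` Sh \<F>1) = card (Sh \<F>1)"
      using insert.hyps by (intro card_image) (auto simp: inj_on_def Sh_def)
    then show ?thesis
      using insert.IH[OF sub(1)] insert.IH[OF sub(2)] by (simp add: Sh_def)
  qed
  also have "\<dots> = card (Sh \<F>0 \<union> insert w ` Sh \<F>1)"
    using finS insert.hyps by (intro card_Un_disjoint[symmetric]) (auto simp: Sh_def)
  also have "\<dots> \<le> card {S. S \<subseteq> insert w W \<and> shatters \<F> S}"
  proof (rule card_mono)
    show "finite {S. S \<subseteq> insert w W \<and> shatters \<F> S}"
      using insert.hyps by (auto intro: finite_subset[of _ "Pow (insert w W)"])
    have "shatters \<F> S" if "S \<in> Sh \<F>0" for S
    proof -
      have "w \<notin> S" using that insert.hyps by (auto simp: Sh_def)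
      then have "S \<inter> (A - {w}) = S \<inter> A" for A by auto
      then show ?thesis
        using that by (simp add: Sh_def shatters_def \<F>0_def image_image)
    qed
    moreover have "shatters \<F> (insert w S)" if S: "S \<in> Sh \<F>1" for S
      unfolding shatters_def
    proof (intro equalityI subsetI)
      fix T assume T: "T \<in> Pow (insert w S)"
      have "w \<notin> S" using S insert.hyps by (auto simp: Sh_def)
      have "T - {w} \<in> Pow S" using T by auto
      moreover have "Pow S = (\<lambda>A. S \<inter> A) ` \<F>1"
        using S by (simp add: Sh_def shatters_def)
      ultimately obtain A where A: "A \<in> \<F>1" "S \<inter> A = T - {w}"
        by (metis imageE)
      show "T \<in> (\<lambda>A. insert w S \<inter> A) ` \<F>"
      proof (cases "w \<in> T")
        case True
        then have "T = insert w S \<inter> insert w A" using A by auto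
        then show ?thesis using A(1) unfolding \<F>1_def by blast
      next
        case False
        then have "T = insert w S \<inter> A" using A by (auto simp: \<F>1_def)
        then show ?thesis using A(1) unfolding \<F>1_def by blast
      qed
    qed auto
    ultimately show "Sh \<F>0 \<union> insert w ` Sh \<F>1 \<subseteq> {S. S \<subseteq> insert w W \<and> shatters \<F> S}"
      by (auto simp: Sh_def)
  qed
  finally show ?case .
qed

lemma shatters_trace_iff:
  assumes "S \<subseteq> W"
  shows "shatters ((\<lambda>A. W \<inter> A) ` \<C>) S \<longleftrightarrow> shatters \<C> S"
proof -
  have "S \<inter> (W \<inter> A) = S \<inter> A" for A using assms by auto
  then show ?thesis by (simp add: shatters_def image_image)
qed

lemma sauer_shelah:
  assumes "finite W" and "vc_dim \<C> \<le> enat V"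
  shows "card ((\<lambda>A. W \<inter> A) ` \<C>) \<le> (\<Sum>i\<le>V. card W choose i)"
proof -
  have "card ((\<lambda>A. W \<inter> A) ` \<C>) \<le> card {S. S \<subseteq> W \<and> shatters ((\<lambda>A. W \<inter> A) ` \<C>) S}"
    using assms by (intro card_le_card_shattered) auto
  also have "\<dots> \<le> card (\<Union>i\<le>V. {S. S \<subseteq> W \<and> card S = i})"
  proof (rule card_mono)
    show "finite (\<Union>i\<le>V. {S. S \<subseteq> W \<and> card S = i})"
      using assms by auto
    have "card S \<le> V" if "S \<subseteq> W" "shatters \<C> S" for S
    proof -
      have "enat (card S) \<le> vc_dim \<C>"
        unfolding vc_dim_def using that assms by (intro SUP_upper) (auto intro: finite_subset)
      also note assms(2)
      finally show ?thesis by simp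
    qed
    then show "{S. S \<subseteq> W \<and> shatters ((\<lambda>A. W \<inter> A) ` \<C>) S} \<subseteq> (\<Union>i\<le>V. {S. S \<subseteq> W \<and> card S = i})"
      by (auto simp: shatters_trace_iff)
  qed
  also have "\<dots> = (\<Sum>i\<le>V. card {S. S \<subseteq> W \<and> card S = i})"
    using assms by (intro card_UN_disjoint) auto
  also have "\<dots> = (\<Sum>i\<le>V. card W choose i)"
    using assms by (simp add: n_subsets)
  finally show ?thesis .
qed

text \<open>
Since \<open>u = V/2n \<le> 1\<close>, replacing \<open>u\<^sup>V\<close> by \<open>u\<^sup>i\<close> only increases the terms, and the full binomial sum is
\<open>(1 + u)\<^sup>2\<^sup>n \<le> e\<^sup>V\<close>.
\<close>

lemma sum_binomial_mult_power_le:
  assumes "V \<le> n" and "n \<ge> 1"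
  shows "(real V / (2 * real n)) ^ V * real (\<Sum>i\<le>V. (2 * n) choose i) \<le> exp (real V)"
proof -
  define u where "u = real V / (2 * real n)"
  have u: "0 \<le> u" "u \<le> 1" using assms by (auto simp: u_def field_simps)
  have "u ^ V * real (\<Sum>i\<le>V. (2 * n) choose i) = (\<Sum>i\<le>V. real ((2 * n) choose i) * u ^ V)"
    by (simp add: sum_distrib_left mult_ac)
  also have "\<dots> \<le> (\<Sum>i\<le>V. real ((2 * n) choose i) * u ^ i)"
    using u by (intro sum_mono mult_left_mono power_decreasing) auto
  also have "\<dots> \<le> (\<Sum>i\<le>2*n. real ((2 * n) choose i) * u ^ i)"
    using u assms by (intro sum_mono2) auto
  also have "\<dots> = (u + 1) ^ (2 * n)"
    by (simp add: binomial_ring mult_ac)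
  also have "\<dots> \<le> exp u ^ (2 * n)"
    using u exp_ge_add_one_self[of u] by (intro power_mono) (auto simp: add.commute)
  also have "\<dots> = exp (real V)"
    using assms by (simp add: u_def flip: exp_of_nat_mult)
  finally show ?thesis by (simp only: u_def)
qed

text \<open>
For \<open>V > n\<close> the minimum in the logarithm is \<open>n\<close> and the trivial bound \<open>2\<^sup>2\<^sup>n\<close> on the number of subsets
suffices.
\<close>

lemma ln_sum_binomial_le:
  assumes "n \<ge> 1" and "V \<ge> 1"
  shows "ln (real (\<Sum>i\<le>V. (2 * n) choose i)) \<le> real V * ln (2 * exp 1 * real n / real (min V n))"
proof -
  define B where "B = (\<Sum>i\<le>V. (2 * n) choose i)"
  have "(2 * n) choose 0 \<le> B"
    unfolding B_def by (intro member_le_sum) auto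
  then have B: "B \<ge> 1" by simp
  have "ln (real B) \<le> real V * ln (2 * exp 1 * real n / real (min V n))"
  proof (cases "V \<le> n")
    case True
    define u where "u = real V / (2 * real n)"
    have u: "0 < u" using assms True by (auto simp: u_def)
    have "u ^ V * real B \<le> exp (real V)"
      unfolding u_def B_def using assms True by (intro sum_binomial_mult_power_le)
    then have "ln (u ^ V * real B) \<le> ln (exp (real V))"
      using u B by (intro ln_mono) auto
    then have "ln (real B) \<le> real V * (1 - ln u)"
      using u B by (simp add: ln_mult ln_realpow algebra_simps)
    also have "1 - ln u = ln (exp 1 / u)"
      using u by (simp add: ln_div)
    also have "exp 1 / u = 2 * exp 1 * real n / real (min V n)"
      using True by (simp add: u_def min_absorb1)
    finally show ?thesis .
  next
    case False
    have "B \<le> (\<Sum>i\<le>max V (2*n). (2 * n) choose i)"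
      unfolding B_def by (intro sum_mono2) auto
    also have "\<dots> = (\<Sum>i\<le>2*n. (2 * n) choose i)"
      by (intro sum.mono_neutral_right) auto
    also have "\<dots> = 2 ^ (2 * n)" by (rule choose_row_sum)
    finally have "real B \<le> real (2 ^ (2 * n))"
      by (rule of_nat_mono)
    then have "ln (real B) \<le> ln (2 ^ (2 * n))"
      using B by (intro ln_mono) auto
    also have "\<dots> = real n * (2 * ln 2)" by (subst ln_realpow) auto
    also have "\<dots> \<le> real V * (ln 2 + 1)"
      using False ln_2_less_1 by (intro mult_mono) auto
    also have "ln 2 + 1 = ln (2 * exp 1 :: real)" by (subst ln_mult) auto
    also have "2 * exp 1 = 2 * exp 1 * real n / real (min V n)"
      using False assms by (simp add: min_absorb2)
    finally show ?thesis .
  qed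
  then show ?thesis by (simp only: B_def)
qed

section \<open>Symmetrization with a ghost sample\<close>

text \<open>
Jensen's inequality for one ghost observation: averaging over it turns the probability of \<open>A\<close> into an
indicator.
\<close>

lemma exp_mean_le_nn_integral:
  assumes "prob_space S" and [measurable]: "A \<in> sets S"
  shows "ennreal (exp (\<alpha> * measure S A)) \<le> (\<integral>\<^sup>+ x. ennreal (exp (\<alpha> * indicator A x)) \<partial>S)"
proof -
  interpret prob_space S by fact
  let ?s = "measure S A"
  have ind: "integrable S (\<lambda>x. (exp \<alpha> - 1) * indicator A x :: real)"
    by (intro integrable_mult_right integrable_real_indicator) (auto simp: emeasure_eq_measure)
  have "exp (\<alpha> * ?s) \<le> (1 - ?s) * exp 0 + ?s * exp \<alpha>"
    using convex_onD[OF exp_convex, of ?s 0 \<alpha>] by (simp add: mult.commute)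
  also have "\<dots> = (\<integral>x. 1 + (exp \<alpha> - 1) * indicator A x \<partial>S)"
    by (subst Bochner_Integration.integral_add[OF _ ind], simp)
      (simp only: integral_mult_right_zero, simp add: prob_space algebra_simps)
  also have "\<dots> = (\<integral>x. exp (\<alpha> * indicator A x) \<partial>S)"
    by (intro Bochner_Integration.integral_cong) (auto simp: indicator_def)
  finally have "ennreal (exp (\<alpha> * ?s)) \<le> ennreal (\<integral>x. exp (\<alpha> * indicator A x) \<partial>S)"
    by (rule ennreal_leI)
  also have "\<dots> = (\<integral>\<^sup>+ x. ennreal (exp (\<alpha> * indicator A x)) \<partial>S)"
    by (intro nn_integral_eq_integral[symmetric] integrable_const_bound[where B="exp \<bar>\<alpha>\<bar>"])
      (auto simp: indicator_def)
  finally show ?thesis .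
qed

text \<open>
The sample occupies the coordinates \<open>1, ..., n\<close> and the ghost sample \<open>n + 1, ..., 2n\<close>; observation \<open>i\<close>
is paired with \<open>n + i\<close>, and the pairs with index in \<open>J\<close> are exchanged.
\<close>

definition swap_pairs :: "nat \<Rightarrow> nat set \<Rightarrow> nat \<Rightarrow> nat" where
  "swap_pairs n J i = (if i \<in> J then n + i else if i \<in> (+) n ` J then i - n else i)"

lemma swap_pairs_inj_on_self:
  assumes "J \<subseteq> {1..n}"
  shows "swap_pairs n J ` {1..2 * n} \<subseteq> {1..2 * n}" and "inj_on (swap_pairs n J) {1..2 * n}"
  using assms by (auto simp: swap_pairs_def inj_on_def subset_eq)

text \<open>
Summing over all \<open>J\<close> amounts to choosing independently for each pair whether to exchange it, so the
sum factors into a product over the pairs.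
\<close>

lemma sum_exp_swap_le:
  fixes c :: "nat \<Rightarrow> real"
  assumes "\<And>i. i \<in> {1..n} \<Longrightarrow> exp (\<alpha> * c (n + i) + \<beta> * c i) + exp (\<alpha> * c i + \<beta> * c (n + i)) \<le> 2"
  shows "(\<Sum>J\<in>Pow {1..n}. exp (\<Sum>i=1..n. \<alpha> * c (swap_pairs n J (n + i)) + \<beta> * c (swap_pairs n J i)))
    \<le> 2 ^ n"
proof -
  define g h where "g i = exp (\<alpha> * c i + \<beta> * c (n + i))"
    and "h i = exp (\<alpha> * c (n + i) + \<beta> * c i)" for i
  have "exp (\<Sum>i=1..n. \<alpha> * c (swap_pairs n J (n + i)) + \<beta> * c (swap_pairs n J i))
      = prod g J * prod h ({1..n} - J)" if J: "J \<in> Pow {1..n}" for J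
  proof -
    have *: "n + i \<notin> J" "(i \<in> (+) n ` J) = False" if "i \<in> {1..n}" for i
      using J that by auto
    have "exp (\<Sum>i=1..n. \<alpha> * c (swap_pairs n J (n + i)) + \<beta> * c (swap_pairs n J i))
      = (\<Prod>i=1..n. if i \<in> J then g i else h i)"
      unfolding exp_sum[OF finite_atLeastAtMost]
      using * by (intro prod.cong) (auto simp: swap_pairs_def g_def h_def)
    also have "\<dots> = prod g ({1..n} \<inter> J) * prod h ({1..n} \<inter> - J)"
      by (simp add: prod.If_cases)
    also have "{1..n} \<inter> J = J" using J by auto
    also have "{1..n} \<inter> - J = {1..n} - J" by auto
    finally show ?thesis .
  qed
  then have "(\<Sum>J\<in>Pow {1..n}. exp (\<Sum>i=1..n. \<alpha> * c (swap_pairs n J (n + i)) + \<beta> * c (swap_pairs n J i)))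
    = (\<Sum>J\<in>Pow {1..n}. prod g J * prod h ({1..n} - J))"
    by (intro sum.cong) auto
  also have "\<dots> = (\<Prod>i=1..n. g i + h i)"
    by (simp add: prod_add)
  also have "\<dots> \<le> (\<Prod>i=1..n. 2)"
    using assms by (intro prod_mono) (auto simp: g_def h_def add.commute intro!: add_nonneg_nonneg)
  finally show ?thesis by simp
qed

lemma nn_integral_PiM_swap:
  assumes "prob_space S" and "J \<subseteq> {1..n}"
    and H: "H \<in> borel_measurable (PiM {1..2 * n} (\<lambda>_. S))"
  shows "(\<integral>\<^sup>+ z. H (\<lambda>i\<in>{1..2*n}. z (swap_pairs n J i)) \<partial>PiM {1..2 * n} (\<lambda>_. S))
    = (\<integral>\<^sup>+ z. H z \<partial>PiM {1..2 * n} (\<lambda>_. S))"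
proof -
  let ?P = "PiM {1..2 * n} (\<lambda>_. S)"
  have m: "(\<lambda>z. \<lambda>i\<in>{1..2*n}. z (swap_pairs n J i)) \<in> measurable ?P ?P"
    using swap_pairs_inj_on_self(1)[OF assms(2)] by (intro measurable_restrict measurable_component_singleton) blast
  have "distr ?P ?P (\<lambda>z. \<lambda>i\<in>{1..2*n}. z (swap_pairs n J i)) = ?P"
    using swap_pairs_inj_on_self[OF assms(2)] assms(1) by (intro distr_PiM_reindex) auto
  then show ?thesis
    using nn_integral_distr[OF m, of H] H by simp
qed

lemma exp_add_le_2_imp_nonpos:
  fixes \<alpha> \<beta> :: real
  assumes "exp \<alpha> + exp \<beta> \<le> 2"
  shows "\<alpha> + \<beta> \<le> 0"
  using assms exp_ge_add_one_self[of \<alpha>] exp_ge_add_one_self[of \<beta>] by linarith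

text \<open>
The exchanges permute the \<open>2n\<close> points without changing the set of their values, so the supremum over
the class is, for all \<open>J\<close> at once, a maximum over the same at most \<open>N\<close> traces and can be bounded by the
sum over them. A pair with exactly one point in the trace contributes \<open>e\<^sup>\<alpha> + e\<^sup>\<beta>\<close>, one with no point
\<open>2\<close>, and one with both points \<open>2 e\<^sup>\<alpha>\<^sup>+\<^sup>\<beta>\<close>; none exceeds \<open>2\<close>.
\<close>

lemma sum_SUP_swap_le:
  fixes z :: "nat \<Rightarrow> 'a"
  assumes ab: "exp \<alpha> + exp \<beta> \<le> 2"
    and N: "card ((\<lambda>A. z ` {1..2 * n} \<inter> A) ` \<D>) \<le> N"
  shows "(\<Sum>J\<in>Pow {1..n}. SUP A\<in>\<D>. ennreal (exp (\<Sum>i=1..n.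
      \<alpha> * indicator A (z (swap_pairs n J (n + i))) + \<beta> * indicator A (z (swap_pairs n J i)))))
    \<le> 2 ^ n * of_nat N"
proof -
  define W where "W = z ` {1..2 * n}"
  define G where "G J A = exp (\<Sum>i=1..n. \<alpha> * indicator A (z (swap_pairs n J (n + i)))
      + \<beta> * indicator A (z (swap_pairs n J i)))" for J A
  define \<T> where "\<T> = (\<lambda>A. W \<inter> A) ` \<D>"
  have fin: "finite \<T>"
    by (rule finite_subset[of _ "Pow W"]) (auto simp: \<T>_def W_def)
  have G_trace: "G J A = G J (W \<inter> A)" if "J \<in> Pow {1..n}" for J A
  proof -
    have "z (swap_pairs n J i) \<in> W" if "i \<in> {1..2*n}" for i
      using swap_pairs_inj_on_self(1)[of J n] \<open>J \<in> Pow {1..n}\<close> that unfolding W_def by blast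
    then show ?thesis
      unfolding G_def by (intro arg_cong[where f=exp] sum.cong) (auto simp: indicator_def)
  qed
  have "(\<Sum>J\<in>Pow {1..n}. SUP A\<in>\<D>. ennreal (G J A)) \<le> (\<Sum>J\<in>Pow {1..n}. \<Sum>T\<in>\<T>. ennreal (G J T))"
  proof (intro sum_mono SUP_least)
    fix J A assume "J \<in> Pow {1..n}" "A \<in> \<D>"
    then show "ennreal (G J A) \<le> (\<Sum>T\<in>\<T>. ennreal (G J T))"
      using fin by (subst G_trace) (auto simp: \<T>_def intro!: member_le_sum)
  qed
  also have "\<dots> = (\<Sum>T\<in>\<T>. \<Sum>J\<in>Pow {1..n}. ennreal (G J T))"
    by (rule sum.swap)
  also have "\<dots> = (\<Sum>T\<in>\<T>. ennreal (\<Sum>J\<in>Pow {1..n}. G J T))"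
    by (intro sum.cong sum_ennreal) (auto simp: G_def)
  also have "\<dots> \<le> (\<Sum>T\<in>\<T>. ennreal (2 ^ n))"
  proof (intro sum_mono ennreal_leI)
    fix T
    have "exp (\<alpha> * indicator T (z (n + i)) + \<beta> * indicator T (z i))
        + exp (\<alpha> * indicator T (z i) + \<beta> * indicator T (z (n + i))) \<le> 2" for i
      using ab exp_add_le_2_imp_nonpos[OF ab] by (auto simp: indicator_def add.commute)
    then show "(\<Sum>J\<in>Pow {1..n}. G J T) \<le> 2 ^ n"
      unfolding G_def by (intro sum_exp_swap_le[where c="\<lambda>i. indicator T (z i)"])
  qed
  also have "\<dots> = 2 ^ n * of_nat (card \<T>)"
    by (simp add: mult.commute ennreal_power[symmetric])
  also have "\<dots> \<le> 2 ^ n * of_nat N"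
    using N by (intro mult_left_mono) (auto simp: \<T>_def W_def)
  finally show ?thesis by (simp add: G_def)
qed

text \<open>
The exponential moment of a weighted difference between the expected and the observed number of
points in a set, uniformly over the class. The condition on \<open>\<alpha>\<close> and \<open>\<beta>\<close> forces a negative drift
\<open>\<alpha> + \<beta>\<close> unless both vanish. Paying this drift, which is proportional to the probability of the set,
keeps the bound free of \<open>n\<close> except through the number of traces.
\<close>

lemma nn_integral_SUP_exp_empirical_le:
  assumes S: "prob_space S" and \<D>: "countable \<D>" "\<D> \<subseteq> sets S"
    and ab: "exp \<alpha> + exp \<beta> \<le> 2"
    and N: "\<And>W. finite W \<Longrightarrow> card W \<le> 2 * n \<Longrightarrow> card ((\<lambda>A. W \<inter> A) ` \<D>) \<le> N"
  shows "(\<integral>\<^sup>+ x. (SUP A\<in>\<D>. ennreal (exp (\<alpha> * (real n * measure S A)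
      + \<beta> * (\<Sum>i=1..n. indicator A (x i))))) \<partial>PiM {1..n} (\<lambda>_. S)) \<le> of_nat N"
proof -
  interpret S: prob_space S by fact
  interpret P: product_prob_space "\<lambda>_. S" "UNIV :: nat set" ..
  define I K where "I = {1..n}" and "K = {1..2 * n}"
  define J where "J = {n + 1..2 * n}"
  have IJ: "I \<inter> J = {}" "finite I" "finite J" "I \<union> J = K"
    by (auto simp: I_def J_def K_def)
  define G where "G A z = exp (\<Sum>i=1..n. \<alpha> * indicator A (z (n + i)) + \<beta> * indicator A (z i))"
    for A and z :: "nat \<Rightarrow> 'a"
  define H where "H z = (SUP A\<in>\<D>. ennreal (G A z))" for z
  have [measurable]: "A \<in> sets S" if "A \<in> \<D>" for A using \<D> that by auto
  have G_meas: "(\<lambda>z. ennreal (G A z)) \<in> borel_measurable (PiM K (\<lambda>_. S))" if A[measurable]: "A \<in> sets S" for A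
  proof -
    have "(\<lambda>z. z i) \<in> measurable (PiM K (\<lambda>_. S)) S" if "i \<in> K" for i
      using that by (rule measurable_component_singleton)
    then have [measurable]: "(\<lambda>z. z i) \<in> measurable (PiM K (\<lambda>_. S)) S"
      "(\<lambda>z. z (n + i)) \<in> measurable (PiM K (\<lambda>_. S)) S" if "i \<in> {1..n}" for i
      using that by (auto simp: K_def)
    show ?thesis unfolding G_def by measurable
  qed
  have H_meas: "H \<in> borel_measurable (PiM K (\<lambda>_. S))"
    unfolding H_def using \<D> G_meas by (intro borel_measurable_SUP) auto
  \<comment> \<open>The expectation over the ghost sample is inserted set by set, before the supremum is taken.\<close>
  have ghost: "(SUP A\<in>\<D>. ennreal (exp (\<alpha> * (real n * measure S A) + \<beta> * (\<Sum>i=1..n. indicator A (x i)))))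
      \<le> (\<integral>\<^sup>+ y. H (merge I J (x, y)) \<partial>PiM J (\<lambda>_. S))" for x
  proof (rule SUP_least)
    fix A assume A: "A \<in> \<D>"
    then have [measurable]: "A \<in> sets S" using \<D> by auto
    have card: "card J = n" by (simp add: J_def)
    have "ennreal (exp (\<alpha> * (real n * measure S A) + \<beta> * (\<Sum>i=1..n. indicator A (x i))))
      = ennreal (exp (\<beta> * (\<Sum>i=1..n. indicator A (x i)))) * ennreal (exp (\<alpha> * measure S A)) ^ n"
      by (simp add: exp_add ennreal_power mult_ac flip: exp_of_nat_mult ennreal_mult)
    also have "\<dots> \<le> ennreal (exp (\<beta> * (\<Sum>i=1..n. indicator A (x i))))
        * (\<integral>\<^sup>+ y. ennreal (exp (\<alpha> * indicator A y)) \<partial>S) ^ n"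
      by (intro mult_left_mono power_mono exp_mean_le_nn_integral S) auto
    also have "(\<integral>\<^sup>+ y. ennreal (exp (\<alpha> * indicator A y)) \<partial>S) ^ n
        = (\<integral>\<^sup>+ y. (\<Prod>j\<in>J. ennreal (exp (\<alpha> * indicator A (y j)))) \<partial>PiM J (\<lambda>_. S))"
      using IJ by (subst P.product_nn_integral_prod) (auto simp: card)
    also have "ennreal (exp (\<beta> * (\<Sum>i=1..n. indicator A (x i)))) * \<dots>
        = (\<integral>\<^sup>+ y. ennreal (exp (\<beta> * (\<Sum>i=1..n. indicator A (x i)))) *
             (\<Prod>j\<in>J. ennreal (exp (\<alpha> * indicator A (y j)))) \<partial>PiM J (\<lambda>_. S))"
    proof (rule nn_integral_cmult[symmetric])
      show "(\<lambda>y. \<Prod>j\<in>J. ennreal (exp (\<alpha> * indicator A (y j)))) \<in> borel_measurable (PiM J (\<lambda>_. S))"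
        by measurable
    qed
    also have "\<dots> = (\<integral>\<^sup>+ y. ennreal (G A (merge I J (x, y))) \<partial>PiM J (\<lambda>_. S))"
    proof (rule nn_integral_cong)
      fix y
      have "(\<Prod>j\<in>J. ennreal (exp (\<alpha> * indicator A (y j)))) = ennreal (exp (\<Sum>j\<in>J. \<alpha> * indicator A (y j)))"
        unfolding exp_sum[OF IJ(3)] by (rule prod_ennreal) simp
      also have "(\<Sum>j\<in>J. \<alpha> * indicator A (y j)) = (\<Sum>i=1..n. \<alpha> * indicator A (y (n + i)))"
        by (rule sum.reindex_bij_witness[of _ "(+) n" "\<lambda>j. j - n"]) (auto simp: J_def)
      also have "\<dots> = (\<Sum>i=1..n. \<alpha> * indicator A (merge I J (x, y) (n + i)))"
        by (intro sum.cong) (auto simp: merge_def I_def J_def)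
      also have "(\<Sum>i=1..n. indicator A (x i)) = (\<Sum>i=1..n. indicator A (merge I J (x, y) i) :: real)"
        by (intro sum.cong) (auto simp: merge_def I_def J_def)
      ultimately show "ennreal (exp (\<beta> * (\<Sum>i=1..n. indicator A (x i)))) *
             (\<Prod>j\<in>J. ennreal (exp (\<alpha> * indicator A (y j)))) = ennreal (G A (merge I J (x, y)))"
        by (simp add: G_def sum.distrib exp_add sum_distrib_left mult.commute flip: ennreal_mult)
    qed
    also have "\<dots> \<le> (\<integral>\<^sup>+ y. H (merge I J (x, y)) \<partial>PiM J (\<lambda>_. S))"
      unfolding H_def using A by (intro nn_integral_mono SUP_upper)
    finally show "ennreal (exp (\<alpha> * (real n * measure S A) + \<beta> * (\<Sum>i=1..n. indicator A (x i))))
        \<le> (\<integral>\<^sup>+ y. H (merge I J (x, y)) \<partial>PiM J (\<lambda>_. S))" .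
  qed
  have "(\<integral>\<^sup>+ x. (SUP A\<in>\<D>. ennreal (exp (\<alpha> * (real n * measure S A)
      + \<beta> * (\<Sum>i=1..n. indicator A (x i))))) \<partial>PiM I (\<lambda>_. S))
      \<le> (\<integral>\<^sup>+ x. (\<integral>\<^sup>+ y. H (merge I J (x, y)) \<partial>PiM J (\<lambda>_. S)) \<partial>PiM I (\<lambda>_. S))"
    by (intro nn_integral_mono ghost)
  also have "\<dots> = (\<integral>\<^sup>+ z. H z \<partial>PiM K (\<lambda>_. S))"
    using P.product_nn_integral_fold[OF IJ(1-3), of H] H_meas by (simp add: IJ)
  also have "\<dots> \<le> of_nat N"
  proof -
    \<comment> \<open>Each of the \<open>2\<^sup>n\<close> exchanges preserves the joint law of the two samples.\<close>
    have "2 ^ n * (\<integral>\<^sup>+ z. H z \<partial>PiM K (\<lambda>_. S)) = (\<Sum>L\<in>Pow I. \<integral>\<^sup>+ z. H z \<partial>PiM K (\<lambda>_. S))"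
      by (simp add: card_Pow I_def)
    also have "\<dots> = (\<Sum>L\<in>Pow I. \<integral>\<^sup>+ z. H (\<lambda>i\<in>K. z (swap_pairs n L i)) \<partial>PiM K (\<lambda>_. S))"
      using H_meas unfolding I_def K_def by (intro sum.cong nn_integral_PiM_swap[symmetric] S) auto
    also have "\<dots> = (\<integral>\<^sup>+ z. (\<Sum>L\<in>Pow I. H (\<lambda>i\<in>K. z (swap_pairs n L i))) \<partial>PiM K (\<lambda>_. S))"
    proof (rule nn_integral_sum[symmetric])
      fix L assume "L \<in> Pow I"
      then have "(\<lambda>z. \<lambda>i\<in>K. z (swap_pairs n L i)) \<in> measurable (PiM K (\<lambda>_. S)) (PiM K (\<lambda>_. S))"
        using swap_pairs_inj_on_self(1)[of L n]
        by (intro measurable_restrict measurable_component_singleton) (unfold I_def K_def, blast)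
      from measurable_compose[OF this H_meas]
      show "(\<lambda>z. H (\<lambda>i\<in>K. z (swap_pairs n L i))) \<in> borel_measurable (PiM K (\<lambda>_. S))" .
    qed
    also have "\<dots> \<le> (\<integral>\<^sup>+ z. 2 ^ n * of_nat N \<partial>PiM K (\<lambda>_. S))"
    proof (rule nn_integral_mono)
      fix z
      have "H (\<lambda>i\<in>K. z (swap_pairs n L i)) = (SUP A\<in>\<D>. ennreal (exp (\<Sum>i=1..n.
        \<alpha> * indicator A (z (swap_pairs n L (n + i))) + \<beta> * indicator A (z (swap_pairs n L i)))))" for L
        unfolding H_def G_def
        by (intro SUP_cong refl arg_cong[where f="\<lambda>t. ennreal (exp t)"] sum.cong) (auto simp: K_def)
      then show "(\<Sum>L\<in>Pow I. H (\<lambda>i\<in>K. z (swap_pairs n L i))) \<le> 2 ^ n * of_nat N"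
        unfolding I_def using card_image_le[of "{1..2*n}" z]
        by (simp only:) (intro sum_SUP_swap_le ab N; simp)
    qed
    also have "\<dots> = 2 ^ n * of_nat N"
      using prob_space.emeasure_space_1[OF prob_space_PiM[of K "\<lambda>_. S", OF S]] by simp
    finally show ?thesis
      by (subst (asm) ennreal_mult_le_mult_iff) (auto simp: power_eq_top_ennreal)
  qed
  finally show ?thesis by (simp add: I_def)
qed

lemma prob_weighted_deviation_le:
  fixes t :: real
  assumes S: "prob_space S" and \<D>: "countable \<D>" "\<D> \<subseteq> sets S"
    and ab: "exp \<alpha> + exp \<beta> \<le> 2"
    and N: "\<And>W. finite W \<Longrightarrow> card W \<le> 2 * n \<Longrightarrow> card ((\<lambda>A. W \<inter> A) ` \<D>) \<le> N"
  defines "B \<equiv> {x \<in> space (PiM {1..n} (\<lambda>_. S)). \<exists>A\<in>\<D>.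
      t \<le> \<alpha> * (real n * measure S A) + \<beta> * (\<Sum>i=1..n. indicator A (x i))}"
  shows "B \<in> sets (PiM {1..n} (\<lambda>_. S))" and "measure (PiM {1..n} (\<lambda>_. S)) B \<le> real N * exp (- t)"
proof -
  let ?P = "PiM {1..n} (\<lambda>_. S)"
  interpret P: prob_space ?P by (intro prob_space_PiM S)
  define F where "F x = (SUP A\<in>\<D>. ennreal (exp (\<alpha> * (real n * measure S A)
      + \<beta> * (\<Sum>i=1..n. indicator A (x i)))))" for x
  have [measurable]: "(\<lambda>x. x i) \<in> measurable ?P S" if "i \<in> {1..n}" for i
    using that by (rule measurable_component_singleton)
  have G_meas: "(\<lambda>x. \<alpha> * (real n * measure S A) + \<beta> * (\<Sum>i=1..n. indicator A (x i))) \<in> borel_measurable ?P"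
    if "A \<in> \<D>" for A
  proof -
    have [measurable]: "A \<in> sets S" using that \<D> by auto
    show ?thesis by measurable
  qed
  have F_meas: "F \<in> borel_measurable ?P"
    unfolding F_def using \<D> G_meas by (intro borel_measurable_SUP) auto
  show B: "B \<in> sets ?P"
  proof -
    have "B = (\<Union>A\<in>\<D>. {x \<in> space ?P.
        t \<le> \<alpha> * (real n * measure S A) + \<beta> * (\<Sum>i=1..n. indicator A (x i))})"
      by (auto simp: B_def)
    also have "\<dots> \<in> sets ?P"
      using \<D> G_meas by (intro sets.countable_UN'') auto
    finally show ?thesis .
  qed
  have "B \<subseteq> {x \<in> space ?P. 1 \<le> ennreal (exp (- t)) * F x}"
  proof
    fix x assume "x \<in> B"
    then obtain A where A: "x \<in> space ?P" "A \<in> \<D>"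
      "t \<le> \<alpha> * (real n * measure S A) + \<beta> * (\<Sum>i=1..n. indicator A (x i))"
      by (auto simp: B_def)
    have "ennreal (exp t) \<le> F x"
      unfolding F_def using A by (intro SUP_upper2[of A]) (auto intro!: ennreal_leI)
    then have "ennreal (exp (- t)) * ennreal (exp t) \<le> ennreal (exp (- t)) * F x"
      by (rule mult_left_mono) simp
    then show "x \<in> {x \<in> space ?P. 1 \<le> ennreal (exp (- t)) * F x}"
      using A by (simp add: exp_minus flip: ennreal_mult)
  qed
  then have "emeasure ?P B \<le> emeasure ?P {x \<in> space ?P. 1 \<le> ennreal (exp (- t)) * F x}"
    using F_meas by (intro emeasure_mono) auto
  also have "\<dots> \<le> ennreal (exp (- t)) * (\<integral>\<^sup>+ x. F x * indicator (space ?P) x \<partial>?P)"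
    using F_meas by (intro nn_integral_Markov_inequality) auto
  also have "(\<integral>\<^sup>+ x. F x * indicator (space ?P) x \<partial>?P) = (\<integral>\<^sup>+ x. F x \<partial>?P)"
    by (intro nn_integral_cong) auto
  also have "ennreal (exp (- t)) * \<dots> \<le> ennreal (exp (- t)) * of_nat N"
    unfolding F_def by (intro mult_left_mono nn_integral_SUP_exp_empirical_le S \<D> ab N) auto
  also have "\<dots> = ennreal (real N * exp (- t))"
    by (simp add: ennreal_mult mult.commute ennreal_of_nat_eq_real_of_nat)
  finally show "measure ?P B \<le> real N * exp (- t)"
    by (subst (asm) P.emeasure_eq_measure) (simp add: ennreal_le_iff)
qed

section \<open>Uniform relative deviations\<close>

text \<open>
The two choices of weights that give the lower and the upper deviation. To second order in \<open>\<theta>\<close> the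
left-hand sides are \<open>2 - \<theta>\<^sup>2/3 + \<theta>\<^sup>2/9\<close>: the drift \<open>-\<theta>\<^sup>2/3\<close> outweighs the variance because of the
factor \<open>1/3\<close>.
\<close>

lemma exp_add_exp_le_2:
  fixes \<theta> :: real
  assumes "0 < \<theta>" and "\<theta> \<le> 1/4"
  shows "exp (\<theta> / 3 * (1 - \<theta>)) + exp (- (\<theta> / 3)) \<le> 2"
    and "exp (- (\<theta> / 3 * (1 + \<theta>))) + exp (\<theta> / 3) \<le> 2"
proof -
  have exp_minus_le: "exp (- x) \<le> 1 - x + x\<^sup>2" if "0 \<le> x" for x :: real
  proof -
    have "1 \<le> (1 - x + x\<^sup>2) * (1 + x)"
      using that by (simp add: algebra_simps power2_eq_square)
    also have "\<dots> \<le> (1 - x + x\<^sup>2) * exp x"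
    proof (intro mult_left_mono)
      have "0 \<le> (x - 1/2)\<^sup>2" by simp
      then show "0 \<le> 1 - x + x\<^sup>2" by (simp add: power2_eq_square algebra_simps)
    qed simp
    finally show ?thesis by (simp add: exp_minus divide_simps)
  qed
  define l where "l = \<theta> / 3"
  have l: "0 < l" "l \<le> 1/12" "\<theta> = 3 * l" using assms by (auto simp: l_def)
  have "exp (l * (1 - \<theta>)) \<le> 1 + l * (1 - \<theta>) + (l * (1 - \<theta>))\<^sup>2"
    using l by (intro exp_bound) (auto simp: mult_le_one)
  moreover have "(l * (1 - \<theta>))\<^sup>2 \<le> l\<^sup>2"
    using l assms by (intro power_mono) (auto simp: mult_le_cancel_left2)
  moreover have "exp (- l) \<le> 1 - l + l\<^sup>2" using l by (intro exp_minus_le) auto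
  ultimately have "exp (l * (1 - \<theta>)) + exp (- l) \<le> 2 - l\<^sup>2"
    by (simp add: l(3) power2_eq_square algebra_simps)
  then show "exp (\<theta> / 3 * (1 - \<theta>)) + exp (- (\<theta> / 3)) \<le> 2"
    unfolding l_def[symmetric] using zero_le_power2[of l] by linarith
  have "exp l \<le> 1 + l + l\<^sup>2" using l by (intro exp_bound) auto
  moreover have "exp (- (l * (1 + \<theta>))) \<le> 1 - l * (1 + \<theta>) + (l * (1 + \<theta>))\<^sup>2"
    using l by (intro exp_minus_le) auto
  moreover have "(l * (1 + \<theta>))\<^sup>2 \<le> (l * (5/4))\<^sup>2"
    using l assms by (intro power_mono) auto
  ultimately have "exp (- (l * (1 + \<theta>))) + exp l \<le> 2 - 3 * l\<^sup>2 + l\<^sup>2 + 25/16 * l\<^sup>2"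
    by (simp add: l(3) power2_eq_square algebra_simps)
  then show "exp (- (\<theta> / 3 * (1 + \<theta>))) + exp (\<theta> / 3) \<le> 2"
    unfolding l_def[symmetric] using zero_le_power2[of l] by linarith
qed

text \<open>
The weights \<open>\<theta>/3 (1 - \<theta>)\<close> and \<open>-\<theta>/3\<close> bound the probability that a frequency is too small, the
weights \<open>-\<theta>/3 (1 + \<theta>)\<close> and \<open>\<theta>/3\<close> that it is too large; dividing by \<open>\<theta>/3\<close> gives the additive term
\<open>3t/\<theta>\<close>. The good event is asserted as a measurable set \<open>G\<close>, so that it can be pulled back to the
space on which the observations live.
\<close>

lemma uniform_relative_deviation:
  assumes S: "prob_space S" and \<D>: "countable \<D>" "\<D> \<subseteq> sets S"
    and N: "\<And>W. finite W \<Longrightarrow> card W \<le> 2 * n \<Longrightarrow> card ((\<lambda>A. W \<inter> A) ` \<D>) \<le> N"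
    and \<theta>: "0 < \<theta>" "\<theta> \<le> 1/4"
  shows "\<exists>G\<in>sets (PiM {1..n} (\<lambda>_. S)).
      1 - 2 * (real N * exp (- t)) \<le> measure (PiM {1..n} (\<lambda>_. S)) G \<and>
      (\<forall>x\<in>G. \<forall>A\<in>\<D>. \<bar>(\<Sum>i=1..n. indicator A (x i)) - real n * measure S A\<bar>
         \<le> \<theta> * (real n * measure S A) + 3 * t / \<theta>)"
proof -
  let ?P = "PiM {1..n} (\<lambda>_. S)"
  interpret P: prob_space ?P by (intro prob_space_PiM S)
  define B where "B \<alpha> \<beta> = {x \<in> space ?P. \<exists>A\<in>\<D>.
      t \<le> \<alpha> * (real n * measure S A) + \<beta> * (\<Sum>i=1..n. indicator A (x i))}" for \<alpha> \<beta>
  define B1 B2 where "B1 = B (\<theta> / 3 * (1 - \<theta>)) (- (\<theta> / 3))"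
    and "B2 = B (- (\<theta> / 3 * (1 + \<theta>))) (\<theta> / 3)"
  have B1: "B1 \<in> sets ?P" "measure ?P B1 \<le> real N * exp (- t)"
    unfolding B1_def B_def
    using prob_weighted_deviation_le[OF S \<D> exp_add_exp_le_2(1)[OF \<theta>] N] by blast+
  have B2: "B2 \<in> sets ?P" "measure ?P B2 \<le> real N * exp (- t)"
    unfolding B2_def B_def
    using prob_weighted_deviation_le[OF S \<D> exp_add_exp_le_2(2)[OF \<theta>] N] by blast+
  show ?thesis
  proof (intro bexI conjI ballI)
    show "space ?P - (B1 \<union> B2) \<in> sets ?P" using B1 B2 by auto
    have "measure ?P (B1 \<union> B2) \<le> 2 * (real N * exp (- t))"
      using measure_Un_le[OF B1(1) B2(1)] B1(2) B2(2) by linarith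
    then show "1 - 2 * (real N * exp (- t)) \<le> measure ?P (space ?P - (B1 \<union> B2))"
      using B1 B2 by (subst P.prob_compl) auto
    fix x A assume x: "x \<in> space ?P - (B1 \<union> B2)" and A: "A \<in> \<D>"
    define s e where "s = real n * measure S A" and "e = (\<Sum>i=1..n. indicator A (x i) :: real)"
    have "\<theta> / 3 * (1 - \<theta>) * s + - (\<theta> / 3) * e < t"
      "- (\<theta> / 3 * (1 + \<theta>)) * s + \<theta> / 3 * e < t"
      using x A by (auto simp: B1_def B2_def B_def s_def e_def not_le)
    then have "\<bar>e - s\<bar> \<le> \<theta> * s + 3 * t / \<theta>"
      using \<theta> by (simp add: field_simps abs_le_iff)
    then show "\<bar>(\<Sum>i=1..n. indicator A (x i)) - real n * measure S A\<bar>
         \<le> \<theta> * (real n * measure S A) + 3 * t / \<theta>"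
      by (simp add: s_def e_def)
  qed
qed

section \<open>Total variation distance and densities\<close>

lemma measure_diff_le_tv_dist:
  assumes "prob_space P" "prob_space Q" "A \<in> sets P"
  shows "measure P A - measure Q A \<le> tv_dist P Q"
proof -
  interpret P: prob_space P by fact
  have "measure P B - measure Q B \<le> 1" for B
    using P.prob_le_1[of B] measure_nonneg[of Q B] by linarith
  then have "bdd_above ((\<lambda>A. measure P A - measure Q A) ` sets P)"
    by (auto simp: bdd_above_def)
  then show ?thesis
    unfolding tv_dist_def using assms(3) by (rule cSUP_upper2) auto
qed

lemma tv_dist_leI:
  assumes "\<And>A. A \<in> sets P \<Longrightarrow> measure P A - measure Q A \<le> c"
  shows "tv_dist P Q \<le> c"
  unfolding tv_dist_def using assms by (intro cSUP_least) auto

lemma abs_measure_diff_le_tv_dist: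
  assumes "prob_space P" "prob_space Q" "sets P = sets Q" "A \<in> sets P"
  shows "\<bar>measure P A - measure Q A\<bar> \<le> tv_dist P Q"
proof -
  interpret P: prob_space P by fact
  interpret Q: prob_space Q by fact
  have sp: "space P = space Q" using assms(3) by (rule sets_eq_imp_space_eq)
  have "measure P (space P - A) - measure Q (space P - A) \<le> tv_dist P Q"
    using assms by (intro measure_diff_le_tv_dist) auto
  then have "measure Q A - measure P A \<le> tv_dist P Q"
    using P.prob_compl[of A] Q.prob_compl[of A] assms by (simp add: sp)
  then show ?thesis
    using measure_diff_le_tv_dist[OF assms(1,2,4)] by linarith
qed

lemma tv_dist_nonneg:
  assumes "prob_space P" "prob_space Q"
  shows "0 \<le> tv_dist P Q"
  using measure_diff_le_tv_dist[OF assms, of "{}"] by simp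

lemma tv_dist_triangle:
  assumes "prob_space P" "prob_space Q" "prob_space R" "sets P = sets Q"
  shows "tv_dist P R \<le> tv_dist P Q + tv_dist Q R"
proof (rule tv_dist_leI)
  fix A assume "A \<in> sets P"
  then have "measure P A - measure Q A \<le> tv_dist P Q" "measure Q A - measure R A \<le> tv_dist Q R"
    using assms by (auto intro!: measure_diff_le_tv_dist)
  then show "measure P A - measure R A \<le> tv_dist P Q + tv_dist Q R" by linarith
qed

lemma tv_dist_commute:
  assumes "prob_space P" "prob_space Q" "sets P = sets Q"
  shows "tv_dist P Q = tv_dist Q P"
proof -
  have "tv_dist P Q \<le> tv_dist Q P" if "prob_space P" "prob_space Q" "sets P = sets Q"
    for P Q :: "'a measure"
    by (rule tv_dist_leI) (use abs_measure_diff_le_tv_dist[of Q P] that in fastforce)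
  from this[OF assms] this[of Q P] show ?thesis using assms by simp
qed

lemma sets_prob_of [simp, measurable_cong]: "sets (prob_of \<mu> p) = sets \<mu>"
  by (simp add: prob_of_def)

lemma space_prob_of [simp]: "space (prob_of \<mu> p) = space \<mu>"
  by (simp add: prob_of_def)

lemma prob_space_prob_of:
  assumes "p \<in> prob_densities \<mu>"
  shows "prob_space (prob_of \<mu> p)"
proof
  have "emeasure (prob_of \<mu> p) (space \<mu>) = (\<integral>\<^sup>+ x. ennreal (p x) * indicator (space \<mu>) x \<partial>\<mu>)"
    using assms unfolding prob_of_def by (intro emeasure_density) (auto simp: prob_densities_def)
  also have "\<dots> = (\<integral>\<^sup>+ x. ennreal (p x) \<partial>\<mu>)"
    by (intro nn_integral_cong) auto
  finally show "emeasure (prob_of \<mu> p) (space (prob_of \<mu> p)) = 1"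
    using assms by (simp add: prob_densities_def)
qed

lemma sets_gt_set [measurable]:
  assumes "p \<in> prob_densities \<mu>" "q \<in> prob_densities \<mu>"
  shows "gt_set \<mu> p q \<in> sets \<mu>"
proof -
  have [measurable]: "p \<in> borel_measurable \<mu>" "q \<in> borel_measurable \<mu>"
    using assms by (auto simp: prob_densities_def)
  show ?thesis unfolding gt_set_def by measurable
qed

lemma le_set_eq_Diff: "le_set \<mu> p q = space \<mu> - gt_set \<mu> p q"
  by (auto simp: le_set_def gt_set_def)

lemma gt_set_subset_le_set: "gt_set \<mu> q p \<subseteq> le_set \<mu> p q"
  by (auto simp: le_set_def gt_set_def)

lemma measure_prob_of_mono:
  assumes p: "p \<in> prob_densities \<mu>" and q: "q \<in> prob_densities \<mu>" and A: "A \<in> sets \<mu>"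
    and le: "\<And>x. x \<in> A \<Longrightarrow> p x \<le> q x"
  shows "measure (prob_of \<mu> p) A \<le> measure (prob_of \<mu> q) A"
proof -
  interpret P: prob_space "prob_of \<mu> p" using p by (rule prob_space_prob_of)
  interpret Q: prob_space "prob_of \<mu> q" using q by (rule prob_space_prob_of)
  have [measurable]: "p \<in> borel_measurable \<mu>" "q \<in> borel_measurable \<mu>"
    using p q by (auto simp: prob_densities_def)
  have "emeasure (prob_of \<mu> p) A \<le> emeasure (prob_of \<mu> q) A"
    unfolding prob_of_def using A le
    by (subst (1 2) emeasure_density) (auto intro!: nn_integral_mono ennreal_leI split: split_indicator)
  then show ?thesis
    by (simp add: P.emeasure_eq_measure Q.emeasure_eq_measure)
qed

text \<open>
The set where the first density is larger attains the supremum: removing from any set its part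
outside, and then adding what is missing inside, can only increase the difference of the masses.
\<close>

lemma tv_dist_prob_of_le:
  assumes p: "p \<in> prob_densities \<mu>" and q: "q \<in> prob_densities \<mu>"
  shows "tv_dist (prob_of \<mu> p) (prob_of \<mu> q)
    \<le> measure (prob_of \<mu> p) (gt_set \<mu> p q) - measure (prob_of \<mu> q) (gt_set \<mu> p q)"
proof (rule tv_dist_leI)
  let ?P = "prob_of \<mu> p" and ?Q = "prob_of \<mu> q" and ?G = "gt_set \<mu> p q"
  interpret P: prob_space ?P using p by (rule prob_space_prob_of)
  interpret Q: prob_space ?Q using q by (rule prob_space_prob_of)
  fix A assume "A \<in> sets ?P"
  then have A[measurable]: "A \<in> sets \<mu>" by simp
  have G[measurable]: "?G \<in> sets \<mu>" using p q by (rule sets_gt_set)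
  have split: "measure M A = measure M (A - ?G) + measure M (A \<inter> ?G)"
    "measure M ?G = measure M (?G - A) + measure M (A \<inter> ?G)"
    if "prob_space M" "sets M = sets \<mu>" for M
  proof -
    interpret M: prob_space M by fact
    show "measure M A = measure M (A - ?G) + measure M (A \<inter> ?G)"
      "measure M ?G = measure M (?G - A) + measure M (A \<inter> ?G)"
      using A G that by (subst M.finite_measure_Union[symmetric]; auto intro!: arg_cong[where f="measure M"])+
  qed
  have "measure ?P (A - ?G) \<le> measure ?Q (A - ?G)"
    using sets.sets_into_space[OF A] sets.Diff[OF A G]
    by (intro measure_prob_of_mono p q) (auto simp: gt_set_def not_less)
  moreover have "measure ?Q (?G - A) \<le> measure ?P (?G - A)"
    using sets.Diff[OF G A] by (intro measure_prob_of_mono p q) (auto simp: gt_set_def)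
  ultimately show "measure ?P A - measure ?Q A \<le> measure ?P ?G - measure ?Q ?G"
    using split[OF P.prob_space_axioms] split[OF Q.prob_space_axioms] by simp
qed

section \<open>The test statistic\<close>

text \<open>
The expectation of \<open>tv_test \<mu> p q\<close> under \<open>S\<close>, written in terms of the probabilities that the
deviation bounds control.
\<close>

definition tv_test_mean :: "'a measure \<Rightarrow> 'a measure \<Rightarrow> ('a \<Rightarrow> real) \<Rightarrow> ('a \<Rightarrow> real) \<Rightarrow> real" where
  "tv_test_mean \<mu> S p q =
     1/2 * (measure S (gt_set \<mu> q p) - measure (prob_of \<mu> q) (gt_set \<mu> q p))
   - 1/2 * (measure S (gt_set \<mu> p q) - measure (prob_of \<mu> p) (gt_set \<mu> p q))"

text \<open>
Under \<open>p \<cdot> \<mu>\<close> itself the mean is \<open>-1/2 \<parallel>p - q\<parallel>\<close>; passing to \<open>S\<close> changes each of the two probabilities by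
at most the distance from \<open>S\<close> to \<open>p \<cdot> \<mu>\<close>.
\<close>

lemma tv_test_mean_le:
  assumes "prob_space S" "sets S = sets \<mu>" and p: "p \<in> prob_densities \<mu>" and q: "q \<in> prob_densities \<mu>"
  shows "tv_test_mean \<mu> S p q \<le> tv_dist S (prob_of \<mu> p) - 1/2 * tv_dist (prob_of \<mu> p) (prob_of \<mu> q)"
proof -
  note ps = prob_space_prob_of[OF p] prob_space_prob_of[OF q]
  have "\<bar>measure S A - measure (prob_of \<mu> p) A\<bar> \<le> tv_dist S (prob_of \<mu> p)" if "A \<in> sets \<mu>" for A
    using assms ps that by (intro abs_measure_diff_le_tv_dist) auto
  from this[OF sets_gt_set[OF p q]] this[OF sets_gt_set[OF q p]]
  have "measure S (gt_set \<mu> q p) - measure (prob_of \<mu> p) (gt_set \<mu> q p) \<le> tv_dist S (prob_of \<mu> p)"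
    "measure (prob_of \<mu> p) (gt_set \<mu> p q) - measure S (gt_set \<mu> p q) \<le> tv_dist S (prob_of \<mu> p)"
    by linarith+
  moreover have "tv_dist (prob_of \<mu> p) (prob_of \<mu> q)
      \<le> measure (prob_of \<mu> q) (gt_set \<mu> q p) - measure (prob_of \<mu> p) (gt_set \<mu> q p)"
    using tv_dist_prob_of_le[OF q p] tv_dist_commute[OF ps] by simp
  ultimately show ?thesis by (simp add: tv_test_mean_def algebra_simps)
qed

text \<open>
The bound on the minimum is used for both orders of the pair. Either \<open>{p \<le> q}\<close> is small under \<open>p \<cdot> \<mu>\<close>;
then so is its subset \<open>{q > p}\<close>, and both sets of interest are controlled through \<open>{p \<le> q}\<close>, one of
them via its complement. Or the same holds with \<open>p\<close> and \<open>q\<close> exchanged. Or \<open>{p > q}\<close> is small under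
\<open>q \<cdot> \<mu>\<close> and \<open>{q > p}\<close> under \<open>p \<cdot> \<mu>\<close>, so that both sets are small themselves. Probabilities under \<open>S\<close>
differ from these by a total variation distance.
\<close>

lemma add_measures_le_of_min_le:
  assumes S: "prob_space S" "sets S = sets \<mu>"
    and p: "p \<in> prob_densities \<mu>" and q: "q \<in> prob_densities \<mu>" and a: "0 \<le> a"
    and pq: "min (measure (prob_of \<mu> p) (le_set \<mu> p q)) (measure (prob_of \<mu> q) (gt_set \<mu> p q))
             \<le> a * tv_dist (prob_of \<mu> p) (prob_of \<mu> q)"
    and qp: "min (measure (prob_of \<mu> q) (le_set \<mu> q p)) (measure (prob_of \<mu> p) (gt_set \<mu> q p))
             \<le> a * tv_dist (prob_of \<mu> q) (prob_of \<mu> p)"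
  defines "m A \<equiv> min (measure S A) (measure S (space \<mu> - A))"
  shows "m (gt_set \<mu> q p) + m (gt_set \<mu> p q)
    \<le> 2 * (1 + a) * (tv_dist S (prob_of \<mu> p) + tv_dist S (prob_of \<mu> q))"
proof -
  let ?P = "prob_of \<mu> p" and ?Q = "prob_of \<mu> q"
  interpret S: prob_space S by fact
  note ps = prob_space_prob_of[OF p] prob_space_prob_of[OF q]
  note [measurable] = sets_gt_set[OF p q] sets_gt_set[OF q p]
  define d where "d = tv_dist ?P ?Q"
  define dp where "dp = tv_dist S ?P"
  define dq where "dq = tv_dist S ?Q"
  have nonneg: "0 \<le> dp" "0 \<le> dq" "0 \<le> d"
    unfolding dp_def dq_def d_def using ps S by (auto intro!: tv_dist_nonneg)
  have "d \<le> dp + dq"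
    unfolding d_def dp_def dq_def
    using tv_dist_triangle[of ?P S ?Q] tv_dist_commute[of S ?P] ps S by simp
  then have "a * d \<le> a * (dp + dq)" using a by (rule mult_left_mono)
  have SP: "measure S A \<le> measure ?P A + dp" if "A \<in> sets \<mu>" for A
    using measure_diff_le_tv_dist[of S ?P A] ps S that by (simp add: dp_def)
  have SQ: "measure S A \<le> measure ?Q A + dq" if "A \<in> sets \<mu>" for A
    using measure_diff_le_tv_dist[of S ?Q A] ps S that by (simp add: dq_def)
  have le_sets: "le_set \<mu> p q \<in> sets \<mu>" "le_set \<mu> q p \<in> sets \<mu>"
    by (auto simp: le_set_eq_Diff)
  have mono: "measure S (gt_set \<mu> q p) \<le> measure S (le_set \<mu> p q)"
    "measure S (gt_set \<mu> p q) \<le> measure S (le_set \<mu> q p)"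
    using le_sets S(2) by (auto intro!: S.finite_measure_mono gt_set_subset_le_set)
  have m: "m (gt_set \<mu> q p) \<le> measure S (gt_set \<mu> q p)" "m (gt_set \<mu> q p) \<le> measure S (le_set \<mu> q p)"
    "m (gt_set \<mu> p q) \<le> measure S (gt_set \<mu> p q)" "m (gt_set \<mu> p q) \<le> measure S (le_set \<mu> p q)"
    by (auto simp: m_def le_set_eq_Diff)
  have dc: "tv_dist ?Q ?P = d" unfolding d_def using ps by (intro tv_dist_commute) auto
  consider "measure ?P (le_set \<mu> p q) \<le> a * d" | "measure ?Q (le_set \<mu> q p) \<le> a * d"
    | "measure ?Q (gt_set \<mu> p q) \<le> a * d" "measure ?P (gt_set \<mu> q p) \<le> a * d"
    using pq qp unfolding dc d_def[symmetric] by linarith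
  then have "m (gt_set \<mu> q p) + m (gt_set \<mu> p q) \<le> 2 * (a * d) + 2 * dp + 2 * dq"
  proof cases
    case 1
    then show ?thesis using m(1,4) mono(1) SP[OF le_sets(1)] nonneg by linarith
  next
    case 2
    then show ?thesis using m(2,3) mono(2) SQ[OF le_sets(2)] nonneg by linarith
  next
    case 3
    then show ?thesis
      using m(1,3) SP[OF sets_gt_set[OF q p]] SQ[OF sets_gt_set[OF p q]] nonneg mult_nonneg_nonneg[OF a nonneg(3)]
      by linarith
  qed
  also have "\<dots> \<le> 2 * (1 + a) * (dp + dq)"
    using \<open>a * d \<le> a * (dp + dq)\<close> by (simp add: algebra_simps)
  finally show ?thesis by (simp only: dp_def dq_def)
qed

text \<open>
Complementary sets have opposite deviations, so each of the two indicators in the test may be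
estimated through whichever of the set and its complement is less likely.
\<close>

lemma sum_tv_test_deviation_le:
  fixes x :: "nat \<Rightarrow> 'a"
  assumes S: "prob_space S" "sets S = sets \<mu>"
    and p: "p \<in> prob_densities \<mu>" and q: "q \<in> prob_densities \<mu>" and a: "0 \<le> a"
    and pq: "min (measure (prob_of \<mu> p) (le_set \<mu> p q)) (measure (prob_of \<mu> q) (gt_set \<mu> p q))
             \<le> a * tv_dist (prob_of \<mu> p) (prob_of \<mu> q)"
    and qp: "min (measure (prob_of \<mu> q) (le_set \<mu> q p)) (measure (prob_of \<mu> p) (gt_set \<mu> q p))
             \<le> a * tv_dist (prob_of \<mu> q) (prob_of \<mu> p)"
    and x: "\<And>i. i \<in> {1..n} \<Longrightarrow> x i \<in> space \<mu>" and \<theta>: "0 \<le> \<theta>"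
    and dev: "\<And>A. A \<in> {gt_set \<mu> q p, gt_set \<mu> p q, space \<mu> - gt_set \<mu> q p, space \<mu> - gt_set \<mu> p q} \<Longrightarrow>
      \<bar>(\<Sum>i=1..n. indicator A (x i)) - real n * measure S A\<bar> \<le> \<theta> * (real n * measure S A) + \<kappa>"
  shows "\<bar>(\<Sum>i=1..n. tv_test \<mu> p q (x i)) - real n * tv_test_mean \<mu> S p q\<bar>
    \<le> \<theta> * (1 + a) * (real n * (tv_dist S (prob_of \<mu> p) + tv_dist S (prob_of \<mu> q))) + \<kappa>"
proof -
  interpret S: prob_space S by fact
  have sp: "space S = space \<mu>" using S(2) by (rule sets_eq_imp_space_eq)
  define e where "e A = (\<Sum>i=1..n. indicator A (x i)) - real n * measure S A" for A
  define m where "m A = min (measure S A) (measure S (space \<mu> - A))" for A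
  have e_le: "\<bar>e A\<bar> \<le> \<theta> * (real n * m A) + \<kappa>" if "A \<in> {gt_set \<mu> q p, gt_set \<mu> p q}" for A
  proof -
    have A: "A \<in> sets S" using that sets_gt_set[OF p q] sets_gt_set[OF q p] S(2) by auto
    have "(\<Sum>i=1..n. indicator (space \<mu> - A) (x i)) = (\<Sum>i=1..n. 1 - indicator A (x i) :: real)"
      using x by (intro sum.cong) (auto simp: indicator_def)
    then have "e (space \<mu> - A) = - e A"
      using S.prob_compl[OF A] by (simp add: e_def sum_subtractf sp right_diff_distrib)
    then have "\<bar>e A\<bar> \<le> \<theta> * (real n * measure S A) + \<kappa>"
      "\<bar>e A\<bar> \<le> \<theta> * (real n * measure S (space \<mu> - A)) + \<kappa>"
      using dev[of A] dev[of "space \<mu> - A"] that by (auto simp: e_def)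
    then show ?thesis by (auto simp: m_def min_def)
  qed
  have "(\<Sum>i=1..n. tv_test \<mu> p q (x i)) - real n * tv_test_mean \<mu> S p q
      = 1/2 * (e (gt_set \<mu> q p) - e (gt_set \<mu> p q))"
    by (simp add: tv_test_def tv_test_mean_def e_def sum_subtractf sum.distrib
        sum_distrib_left[symmetric] algebra_simps flip: sum_divide_distrib)
  then have 1: "\<bar>(\<Sum>i=1..n. tv_test \<mu> p q (x i)) - real n * tv_test_mean \<mu> S p q\<bar>
      \<le> \<theta> * real n / 2 * (m (gt_set \<mu> q p) + m (gt_set \<mu> p q)) + \<kappa>"
    using e_le[of "gt_set \<mu> q p"] e_le[of "gt_set \<mu> p q"] by (simp add: algebra_simps)
  have "m (gt_set \<mu> q p) + m (gt_set \<mu> p q)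
      \<le> 2 * (1 + a) * (tv_dist S (prob_of \<mu> p) + tv_dist S (prob_of \<mu> q))"
    unfolding m_def by (intro add_measures_le_of_min_le assms)
  then have "\<theta> * real n / 2 * (m (gt_set \<mu> q p) + m (gt_set \<mu> p q)) \<le>
      \<theta> * real n / 2 * (2 * (1 + a) * (tv_dist S (prob_of \<mu> p) + tv_dist S (prob_of \<mu> q)))"
    using \<theta> by (intro mult_left_mono) auto
  also have "\<dots> = \<theta> * (1 + a) * (real n * (tv_dist S (prob_of \<mu> p) + tv_dist S (prob_of \<mu> q)))"
    by (simp add: algebra_simps)
  finally show ?thesis using 1 by linarith
qed

lemma tv_test_swap: "tv_test \<mu> q p x = - tv_test \<mu> p q x"
  by (simp add: tv_test_def)

lemma abs_sum_tv_test_le: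
  assumes "p \<in> prob_densities \<mu>" "q \<in> prob_densities \<mu>"
  shows "\<bar>\<Sum>i=1..n. tv_test \<mu> p q (x i)\<bar> \<le> real n"
proof -
  interpret P: prob_space "prob_of \<mu> p" using assms by (intro prob_space_prob_of)
  interpret Q: prob_space "prob_of \<mu> q" using assms by (intro prob_space_prob_of)
  have unit: "\<bar>1/2 * (i - v) - 1/2 * (j - u)\<bar> \<le> 1"
    if "0 \<le> i" "i \<le> 1" "0 \<le> j" "j \<le> 1" "0 \<le> u" "u \<le> 1" "0 \<le> v" "v \<le> 1" for i j u v :: real
    using that by (simp add: abs_le_iff field_simps)
  have t: "\<bar>tv_test \<mu> p q y\<bar> \<le> 1" for y
    unfolding tv_test_def by (rule unit) (simp_all add: indicator_le_1)
  have "\<bar>\<Sum>i=1..n. tv_test \<mu> p q (x i)\<bar> \<le> (\<Sum>i=1..n. \<bar>tv_test \<mu> p q (x i)\<bar>)"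
    by (rule sum_abs)
  also have "\<dots> \<le> (\<Sum>i=1..n. 1)" by (intro sum_mono t)
  finally show ?thesis by simp
qed

section \<open>The risk bound\<close>

text \<open>
With \<open>E = \<parallel>r - p\<parallel> \<ge> D p - D r\<close>, the statistic of \<open>p\<close> is at least \<open>\<Sum>t\<^sub>p\<^sub>r = -\<Sum>t\<^sub>r\<^sub>p\<close>, hence at least
\<open>n (D p/4 - 7/4 D r) - \<kappa>\<close>. For the statistic of \<open>r\<close>, the term \<open>D q/4 \<le> (D r + E\<^sub>q)/4\<close> with
\<open>E\<^sub>q = \<parallel>r - q\<parallel>\<close> is absorbed by the drift \<open>-E\<^sub>q/2\<close>, which leaves \<open>3/2 n D r + \<kappa>\<close> for every \<open>q\<close>.
\<close>

lemma tv_estimator_loss_le: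
  assumes S: "prob_space S" "sets S = sets \<mu>" and M: "\<M> \<subseteq> prob_densities \<mu>"
    and r: "r \<in> \<M>" and p: "p \<in> \<M>" and n: "n \<ge> 1"
    and dev: "\<And>q. q \<in> \<M> \<Longrightarrow> \<bar>(\<Sum>i=1..n. tv_test \<mu> r q (x i)) - real n * tv_test_mean \<mu> S r q\<bar>
      \<le> 1/4 * (real n * (tv_dist S (prob_of \<mu> r) + tv_dist S (prob_of \<mu> q))) + \<kappa>"
    and est: "tv_stat \<mu> \<M> n x p \<le> (INF p'\<in>\<M>. tv_stat \<mu> \<M> n x p') + \<epsilon>"
  shows "tv_dist S (prob_of \<mu> p) \<le> 13 * tv_dist S (prob_of \<mu> r) + (8 * \<kappa> + 4 * \<epsilon>) / real n"
proof -
  define T where "T r q = (\<Sum>i=1..n. tv_test \<mu> r q (x i))" for r q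
  define D where "D q = tv_dist S (prob_of \<mu> q)" for q
  define E where "E r q = tv_dist (prob_of \<mu> r) (prob_of \<mu> q)" for r q
  have T_bound: "\<bar>T r' q\<bar> \<le> real n" if "r' \<in> \<M>" "q \<in> \<M>" for r' q
    unfolding T_def using that M by (intro abs_sum_tv_test_le) auto
  have bdd: "bdd_above (T r' ` \<M>)" if "r' \<in> \<M>" for r'
    using T_bound[OF that] by (intro bdd_aboveI2[where M="real n"]) (auto simp: abs_le_iff)
  have stat: "tv_stat \<mu> \<M> n x r' = (SUP q\<in>\<M>. T r' q)" for r'
    by (simp add: tv_stat_def T_def)
  have stat_ge: "T r' q \<le> tv_stat \<mu> \<M> n x r'" if "r' \<in> \<M>" "q \<in> \<M>" for r' q
    unfolding stat using bdd[OF that(1)] that(2) by (rule cSUP_upper2) auto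
  have "- real n \<le> tv_stat \<mu> \<M> n x r'" if "r' \<in> \<M>" for r'
    using stat_ge[OF that r] T_bound[OF that r] by linarith
  then have "bdd_below (tv_stat \<mu> \<M> n x ` \<M>)" by (auto intro!: bdd_belowI2)
  then have "(INF p'\<in>\<M>. tv_stat \<mu> \<M> n x p') \<le> tv_stat \<mu> \<M> n x r"
    using r by (rule cINF_lower2) auto
  then have upper: "T p r \<le> tv_stat \<mu> \<M> n x r + \<epsilon>"
    using stat_ge[OF p r] est by linarith
  have prob: "prob_space (prob_of \<mu> q)" if "q \<in> \<M>" for q
    using that M by (intro prob_space_prob_of) auto
  have triangle: "D q \<le> D r + E r q" "D r \<le> D q + E r q" if "q \<in> \<M>" for q
  proof -
    show "D q \<le> D r + E r q"
      unfolding D_def E_def using prob[OF that] prob[OF r] S by (intro tv_dist_triangle) auto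
    have "D r \<le> D q + tv_dist (prob_of \<mu> q) (prob_of \<mu> r)"
      unfolding D_def using prob[OF that] prob[OF r] S by (intro tv_dist_triangle) auto
    also have "tv_dist (prob_of \<mu> q) (prob_of \<mu> r) = E r q"
      unfolding E_def using prob[OF that] prob[OF r] by (intro tv_dist_commute) auto
    finally show "D r \<le> D q + E r q" .
  qed
  have T_le: "T r q \<le> real n * (tv_test_mean \<mu> S r q + 1/4 * (D r + D q)) + \<kappa>" if "q \<in> \<M>" for q
    using dev[OF that] by (simp add: T_def D_def abs_le_iff algebra_simps)
  have mean_le: "tv_test_mean \<mu> S r q \<le> D r - 1/2 * E r q" if "q \<in> \<M>" for q
    unfolding D_def E_def using S M r that by (intro tv_test_mean_le) auto
  have "T r q \<le> real n * (3/2 * D r) + \<kappa>" if q: "q \<in> \<M>" for q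
  proof -
    have "0 \<le> E r q" unfolding E_def using prob[OF q] prob[OF r] by (rule tv_dist_nonneg[rotated])
    then have "tv_test_mean \<mu> S r q + 1/4 * (D r + D q) \<le> 3/2 * D r"
      using mean_le[OF q] triangle(1)[OF q] by (simp add: field_simps)
    then have "real n * (tv_test_mean \<mu> S r q + 1/4 * (D r + D q)) \<le> real n * (3/2 * D r)"
      by (intro mult_left_mono) auto
    then show ?thesis using T_le[OF q] by linarith
  qed
  then have "tv_stat \<mu> \<M> n x r \<le> real n * (3/2 * D r) + \<kappa>"
    unfolding stat using r by (intro cSUP_least) auto
  moreover have "real n * (1/4 * D p - 7/4 * D r) - \<kappa> \<le> T p r"
  proof -
    have "tv_test_mean \<mu> S r p \<le> D r - 1/2 * (D p - D r)"
      using mean_le[OF p] triangle(1)[OF p] by (simp add: field_simps)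
    then have "tv_test_mean \<mu> S r p + 1/4 * (D r + D p) \<le> - (1/4 * D p - 7/4 * D r)"
      by (simp add: field_simps)
    then have "real n * (tv_test_mean \<mu> S r p + 1/4 * (D r + D p)) \<le> real n * - (1/4 * D p - 7/4 * D r)"
      by (intro mult_left_mono) auto
    moreover have "T p r = - T r p" by (simp add: T_def tv_test_swap[of \<mu> p r] sum_negf)
    ultimately show ?thesis using T_le[OF p] unfolding mult_minus_right by linarith
  qed
  ultimately have "real n * (1/4 * D p - 7/4 * D r) - \<kappa> \<le> real n * (3/2 * D r) + \<kappa> + \<epsilon>"
    using upper by linarith
  then have "real n * D p \<le> real n * (13 * D r) + (8 * \<kappa> + 4 * \<epsilon>)"
    by (simp add: algebra_simps)
  then have "D p \<le> 13 * D r + (8 * \<kappa> + 4 * \<epsilon>) / real n"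
    using n by (simp add: field_simps)
  then show ?thesis by (simp only: D_def)
qed

lemma card_le_of_subset_Un_images:
  assumes "finite \<T>1" "finite \<T>2" "card \<T>1 \<le> B" "card \<T>2 \<le> B"
    and "\<T> \<subseteq> \<T>1 \<union> \<T>2 \<union> f ` \<T>1 \<union> f ` \<T>2"
  shows "card \<T> \<le> 4 * B"
proof -
  have "card \<T> \<le> card (\<T>1 \<union> \<T>2 \<union> f ` \<T>1 \<union> f ` \<T>2)"
    using assms by (intro card_mono) auto
  also have "\<dots> \<le> card \<T>1 + card \<T>2 + card (f ` \<T>1) + card (f ` \<T>2)"
    using card_Un_le[of "\<T>1 \<union> \<T>2 \<union> f ` \<T>1" "f ` \<T>2"] card_Un_le[of "\<T>1 \<union> \<T>2" "f ` \<T>1"]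
      card_Un_le[of \<T>1 \<T>2] by linarith
  also have "\<dots> \<le> 4 * B"
    using card_image_le[OF assms(1), of f] card_image_le[OF assms(2), of f] assms(3,4) by linarith
  finally show ?thesis .
qed

text \<open>
The trace of a complement is determined by the trace of the set, so each class of complements has at
most as many traces as the original class.
\<close>

lemma card_trace_Un_complements_le:
  assumes W: "finite W" "card W \<le> m"
    and C1: "vc_dim \<C>\<^sub>1 \<le> enat V" and C2: "vc_dim \<C>\<^sub>2 \<le> enat V"
  shows "card ((\<lambda>A. W \<inter> A) ` (\<C>\<^sub>1 \<union> \<C>\<^sub>2 \<union> (\<lambda>A. U - A) ` \<C>\<^sub>1 \<union> (\<lambda>A. U - A) ` \<C>\<^sub>2))
    \<le> 4 * (\<Sum>i\<le>V. m choose i)"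
proof (rule card_le_of_subset_Un_images)
  let ?tr = "\<lambda>\<C>. (\<lambda>A. W \<inter> A) ` \<C>"
  show "finite (?tr \<C>\<^sub>1)" "finite (?tr \<C>\<^sub>2)"
    by (auto intro!: finite_subset[of _ "Pow W"] simp: W)
  have "(\<Sum>i\<le>V. card W choose i) \<le> (\<Sum>i\<le>V. m choose i)"
    using W by (intro sum_mono binomial_right_mono)
  then show "card (?tr \<C>\<^sub>1) \<le> (\<Sum>i\<le>V. m choose i)" "card (?tr \<C>\<^sub>2) \<le> (\<Sum>i\<le>V. m choose i)"
    using sauer_shelah[OF W(1) C1] sauer_shelah[OF W(1) C2] by linarith+
  have "W \<inter> (U - A) = W \<inter> U - W \<inter> A" for A by auto
  then show "?tr (\<C>\<^sub>1 \<union> \<C>\<^sub>2 \<union> (\<lambda>A. U - A) ` \<C>\<^sub>1 \<union> (\<lambda>A. U - A) ` \<C>\<^sub>2)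
      \<subseteq> ?tr \<C>\<^sub>1 \<union> ?tr \<C>\<^sub>2 \<union> (\<lambda>T. W \<inter> U - T) ` ?tr \<C>\<^sub>1 \<union> (\<lambda>T. W \<inter> U - T) ` ?tr \<C>\<^sub>2"
    by (simp add: image_Un image_image)
qed

text \<open>
Elements of the closure are limits of elements of the model, so the infimum over the closure is
approached inside the model.
\<close>

lemma near_minimizer_in_model:
  assumes S: "prob_space S" "sets S = sets \<mu>" and M: "\<M> \<subseteq> prob_densities \<mu>" "\<M> \<noteq> {}" and "0 < \<delta>"
  shows "0 \<le> (INF P\<in>tv_closure \<mu> (model \<mu> \<M>). tv_dist S P)"
    and "\<exists>r\<in>\<M>. tv_dist S (prob_of \<mu> r) \<le> (INF P\<in>tv_closure \<mu> (model \<mu> \<M>). tv_dist S P) + \<delta>"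
proof -
  let ?C = "tv_closure \<mu> (model \<mu> \<M>)"
  have prob: "prob_space (prob_of \<mu> q)" if "q \<in> \<M>" for q
    using that M by (intro prob_space_prob_of) auto
  have bdd: "bdd_below (tv_dist P ` model \<mu> \<M>)" if "prob_space P" for P
    using that prob by (intro bdd_belowI2[where m=0] tv_dist_nonneg) (auto simp: model_def)
  obtain q where q: "q \<in> \<M>" using M by auto
  have "prob_of \<mu> q \<in> ?C"
  proof -
    have "tv_dist (prob_of \<mu> q) (prob_of \<mu> q) \<le> 0"
      by (rule tv_dist_leI) simp
    then have "(INF Q\<in>model \<mu> \<M>. tv_dist (prob_of \<mu> q) Q) \<le> 0"
      using q by (intro cINF_lower2[OF bdd[OF prob[OF q]], of "prob_of \<mu> q"]) (auto simp: model_def)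
    moreover have "0 \<le> (INF Q\<in>model \<mu> \<M>. tv_dist (prob_of \<mu> q) Q)"
      using q prob by (intro cINF_greatest tv_dist_nonneg) (auto simp: model_def)
    ultimately show ?thesis using prob[OF q] by (simp add: tv_closure_def)
  qed
  then have ne: "?C \<noteq> {}" by auto
  have "0 \<le> tv_dist S P" if "P \<in> ?C" for P
    using that S by (intro tv_dist_nonneg) (auto simp: tv_closure_def)
  then show "0 \<le> (INF P\<in>?C. tv_dist S P)"
    using ne by (intro cINF_greatest) auto
  have "(INF P\<in>?C. tv_dist S P) < (INF P\<in>?C. tv_dist S P) + \<delta> / 2"
    using \<open>0 < \<delta>\<close> by simp
  then obtain P where P: "P \<in> ?C" "tv_dist S P < (INF P\<in>?C. tv_dist S P) + \<delta> / 2"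
    using cInf_lessD[of "tv_dist S ` ?C"] ne by blast
  then have P': "prob_space P" "sets P = sets \<mu>" "(INF Q\<in>model \<mu> \<M>. tv_dist P Q) < \<delta> / 2"
    using \<open>0 < \<delta>\<close> by (auto simp: tv_closure_def)
  have "tv_dist P ` model \<mu> \<M> \<noteq> {}" using q by (auto simp: model_def)
  then obtain r where r: "r \<in> \<M>" "tv_dist P (prob_of \<mu> r) < \<delta> / 2"
    using cInf_lessD[OF _ P'(3)] by (auto simp: model_def)
  have "tv_dist S (prob_of \<mu> r) \<le> tv_dist S P + tv_dist P (prob_of \<mu> r)"
    using S P' prob[OF r(1)] by (intro tv_dist_triangle) auto
  then show "\<exists>r\<in>\<M>. tv_dist S (prob_of \<mu> r) \<le> (INF P\<in>?C. tv_dist S P) + \<delta>"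
    using P(2) r by (intro bexI[of _ r]) auto
qed

lemma measure_iid_sample:
  fixes n :: nat
  assumes \<Omega>: "prob_space \<Omega>" and n: "n \<ge> 1" and S: "sets S = sets \<mu>"
    and indep: "prob_space.indep_vars \<Omega> (\<lambda>_. \<mu>) X {1..n}"
    and distr: "\<And>i. i \<in> {1..n} \<Longrightarrow> distr \<Omega> \<mu> (X i) = S"
    and G: "G \<in> sets (PiM {1..n} (\<lambda>_. S))"
  shows "{\<omega> \<in> space \<Omega>. (\<lambda>i\<in>{1..n}. X i \<omega>) \<in> G} \<in> sets \<Omega>"
    and "measure \<Omega> {\<omega> \<in> space \<Omega>. (\<lambda>i\<in>{1..n}. X i \<omega>) \<in> G} = measure (PiM {1..n} (\<lambda>_. S)) G"
proof -
  interpret prob_space \<Omega> by fact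
  let ?X = "\<lambda>\<omega>. \<lambda>i\<in>{1..n}. X i \<omega>"
  have rv: "X i \<in> measurable \<Omega> \<mu>" if "i \<in> {1..n}" for i
    using indep that by (auto simp: indep_vars_def)
  have sets: "sets (PiM {1..n} (\<lambda>_. S)) = sets (PiM {1..n} (\<lambda>_. \<mu>))"
    using S by (intro sets_PiM_cong) auto
  have m: "?X \<in> measurable \<Omega> (PiM {1..n} (\<lambda>_. \<mu>))"
    using rv by (intro measurable_restrict) auto
  have eq: "{\<omega> \<in> space \<Omega>. ?X \<omega> \<in> G} = ?X -` G \<inter> space \<Omega>" by auto
  show "{\<omega> \<in> space \<Omega>. ?X \<omega> \<in> G} \<in> sets \<Omega>"
    unfolding eq using m G sets by (intro measurable_sets) auto
  have "distr \<Omega> (PiM {1..n} (\<lambda>_. \<mu>)) ?X = PiM {1..n} (\<lambda>i. distr \<Omega> \<mu> (X i))"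
  proof (rule iffD1[OF indep_vars_iff_distr_eq_PiM' indep])
    show "{1..n} \<noteq> {}" using n by simp
  qed (rule rv)
  also have "\<dots> = PiM {1..n} (\<lambda>_. S)"
    using distr by (intro PiM_cong) auto
  finally show "measure \<Omega> {\<omega> \<in> space \<Omega>. ?X \<omega> \<in> G} = measure (PiM {1..n} (\<lambda>_. S)) G"
    unfolding eq using m G sets by (subst measure_distr[symmetric, of ?X \<Omega> "PiM {1..n} (\<lambda>_. \<mu>)"]) auto
qed

text \<open>
The bookkeeping of constants: \<open>96 (ln 8 + b) + 153 \<le> 96 \<cdot> 4 v l + 153 v l\<close> is far below the constant
in front of \<open>v l\<close>, and \<open>96 a \<xi> \<le> 144 a \<xi>\<close>.
\<close>

lemma remainder_le:
  fixes a l \<xi> \<epsilon> v :: real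
  assumes "1 \<le> a" "1 \<le> v" "1 \<le> l" "0 \<le> \<xi>" "\<epsilon> \<le> 35" and b: "b \<le> v * l"
  shows "13 + 8 * (12 * a * (ln 8 + b + \<xi>)) + 4 * \<epsilon> \<le> 144 * a * (450000 * a\<^sup>2 * v * l + 1 + \<xi>)"
proof -
  have vl: "1 \<le> v * l" using mult_mono[OF assms(2,3)] assms by simp
  have "1 \<le> a\<^sup>2" using assms by simp
  then have "1 * (v * l) \<le> a\<^sup>2 * (v * l)" using vl by (intro mult_right_mono) auto
  then have av: "v * l \<le> a\<^sup>2 * v * l" by (simp add: mult.assoc)
  have "ln 8 = 3 * ln (2::real)" using ln_realpow[of 2 3] by simp
  then have ln8: "ln 8 \<le> (3::real)" using ln_2_less_1 by simp
  have "96 * a * (ln 8 + b + \<xi>) \<le> 96 * a * (3 * (v * l) + v * l + \<xi>)"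
  proof (rule mult_left_mono)
    show "ln 8 + b + \<xi> \<le> 3 * (v * l) + v * l + \<xi>"
      using ln8 b vl by linarith
  qed (use assms in simp)
  moreover have "153 \<le> a * (153 * (v * l))"
    using mult_mono[of 1 a 153 "153 * (v * l)"] vl assms by simp
  moreover have "a * (v * l) \<le> a * (a\<^sup>2 * v * l)" using av assms by (intro mult_left_mono) auto
  moreover have "0 \<le> a * \<xi>" "0 \<le> a * (v * l)" using assms vl by auto
  moreover have "96 * a * (3 * (v * l) + v * l + \<xi>) = 384 * (a * (v * l)) + 96 * (a * \<xi>)"
    by (simp add: algebra_simps)
  moreover have "144 * a * (450000 * a\<^sup>2 * v * l + 1 + \<xi>)
      = 64800000 * (a * (a\<^sup>2 * v * l)) + 144 * a + 144 * (a * \<xi>)"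
    by (simp add: algebra_simps)
  moreover have "a * (153 * (v * l)) = 153 * (a * (v * l))" by simp
  ultimately show ?thesis using assms by linarith
qed

theorem corollary11:
  fixes \<mu> Pstar :: "'a measure" and \<Omega> :: "'w measure"
    and \<M> :: "('a \<Rightarrow> real) set" and X :: "nat \<Rightarrow> 'w \<Rightarrow> 'a" and Phat :: "'w \<Rightarrow> 'a measure"
    and n V :: nat and \<epsilon> a\<^sub>2' a\<^sub>2 \<xi> :: real
  assumes "sigma_finite_measure \<mu>"
    and "0 < \<epsilon>" and "\<epsilon> \<le> 35"
    and "n \<ge> 1"
    and "prob_space Pstar" and "sets Pstar = sets \<mu>"
    and "prob_space \<Omega>"
    and "prob_space.indep_vars \<Omega> (\<lambda>_. \<mu>) X {1..n}"
    and "\<And>i. i \<in> {1..n} \<Longrightarrow> distr \<Omega> \<mu> (X i) = Pstar"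
    and "countable \<M>" and "\<M> \<subseteq> prob_densities \<mu>"
    and "a\<^sub>2' \<ge> 0"
    and "\<And>p q. p \<in> \<M> \<Longrightarrow> q \<in> \<M> \<Longrightarrow>
           min (measure (prob_of \<mu> p) (le_set \<mu> p q)) (measure (prob_of \<mu> q) (gt_set \<mu> p q))
             \<le> a\<^sub>2' * tv_dist (prob_of \<mu> p) (prob_of \<mu> q)"
    and "a\<^sub>2 = 1 + a\<^sub>2'"
    and "V \<ge> 1"
    and "\<And>p. p \<in> \<M> \<Longrightarrow> vc_dim {gt_set \<mu> q p | q. q \<in> \<M> - {p}} \<le> enat V"
    and "\<And>p. p \<in> \<M> \<Longrightarrow> vc_dim {gt_set \<mu> p q | q. q \<in> \<M> - {p}} \<le> enat V"
    and "tv_estimator \<Omega> \<mu> \<M> n X \<epsilon> Phat"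
    and "\<xi> > 0"
  shows "measure \<Omega> {\<omega> \<in> space \<Omega>.
           tv_dist Pstar (Phat \<omega>)
             \<le> 14 * (INF P\<in>tv_closure \<mu> (model \<mu> \<M>). tv_dist Pstar P)
               + 144 * a\<^sub>2 / real n *
                 (450000 * a\<^sub>2^2 * real V * ln (2 * exp 1 * real n / real (min V n)) + 1 + \<xi>)}
         \<ge> 1 - exp (- \<xi>)"
proof -
  define S where "S = Pstar"
  interpret \<Omega>: prob_space \<Omega> by fact
  have S: "prob_space S" "sets S = sets \<mu>" using assms by (simp_all add: S_def)
  have \<M>: "\<M> \<subseteq> prob_densities \<mu>" by fact
  have est: "Phat \<in> measurable \<Omega> (count_space (model \<mu> \<M>))"
    "\<And>\<omega>. \<omega> \<in> space \<Omega> \<Longrightarrow> \<exists>p\<in>\<M>. Phat \<omega> = prob_of \<mu> p \<and>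
      tv_stat \<mu> \<M> n (\<lambda>i. X i \<omega>) p \<le> (INF p'\<in>\<M>. tv_stat \<mu> \<M> n (\<lambda>i. X i \<omega>) p') + \<epsilon>"
    using \<open>tv_estimator \<Omega> \<mu> \<M> n X \<epsilon> Phat\<close> by (auto simp: tv_estimator_def)
  have "\<M> \<noteq> {}" using est(2) \<Omega>.not_empty by blast
  define I where "I = (INF P\<in>tv_closure \<mu> (model \<mu> \<M>). tv_dist S P)"
  have "0 < 1 / real n" using \<open>n \<ge> 1\<close> by simp
  note near = near_minimizer_in_model[OF S \<M> \<open>\<M> \<noteq> {}\<close> this, folded I_def]
  \<comment> \<open>The infimum need not be attained; the error \<open>1/n\<close> goes into the remainder.\<close>
  obtain r where r: "r \<in> \<M>" "tv_dist S (prob_of \<mu> r) \<le> I + 1 / real n"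
    using near(2) by blast
  define \<C>\<^sub>1 \<C>\<^sub>2 where "\<C>\<^sub>1 = {gt_set \<mu> q r | q. q \<in> \<M> - {r}}" and "\<C>\<^sub>2 = {gt_set \<mu> r q | q. q \<in> \<M> - {r}}"
  define \<D> where "\<D> = \<C>\<^sub>1 \<union> \<C>\<^sub>2 \<union> (\<lambda>A. space \<mu> - A) ` \<C>\<^sub>1 \<union> (\<lambda>A. space \<mu> - A) ` \<C>\<^sub>2"
  define B where "B = (\<Sum>i\<le>V. (2 * n) choose i)"
  \<comment> \<open>This \<open>\<theta>\<close> makes the coefficient \<open>\<theta> a\<^sub>2\<close> of the two distances equal to \<open>1/4\<close>; the \<open>8\<close> in \<open>t\<close>
    accounts for two directions of deviation and four classes of sets.\<close>
  define \<theta> t where "\<theta> = 1 / (4 * a\<^sub>2)" and "t = ln (8 * real B) + \<xi>"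
  have a2: "1 \<le> a\<^sub>2" using assms by simp
  have "(2 * n) choose 0 \<le> B"
    unfolding B_def by (intro member_le_sum) auto
  then have B: "B \<ge> 1" by simp
  have countable: "countable \<C>\<^sub>1" "countable \<C>\<^sub>2"
    unfolding \<C>\<^sub>1_def \<C>\<^sub>2_def Setcompr_eq_image using \<open>countable \<M>\<close> by auto
  have "\<C>\<^sub>1 \<subseteq> sets \<mu>" "\<C>\<^sub>2 \<subseteq> sets \<mu>"
    using \<M> r(1) by (auto simp: \<C>\<^sub>1_def \<C>\<^sub>2_def intro!: sets_gt_set)
  then have \<D>: "countable \<D>" "\<D> \<subseteq> sets S"
    unfolding \<D>_def S(2) using countable by (intro countable_Un countable_image, blast+)
  have traces: "card ((\<lambda>A. W \<inter> A) ` \<D>) \<le> 4 * B" if "finite W" "card W \<le> 2 * n" for W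
    unfolding \<D>_def B_def using that assms(16,17)[OF r(1)]
    by (intro card_trace_Un_complements_le) (simp_all add: \<C>\<^sub>1_def \<C>\<^sub>2_def)
  have \<theta>: "0 < \<theta>" "\<theta> \<le> 1/4" using a2 by (simp_all add: \<theta>_def field_simps)
  note uniform = uniform_relative_deviation[OF S(1) \<D> traces \<theta>, where t=t]
  obtain G where G: "G \<in> sets (PiM {1..n} (\<lambda>_. S))"
    and G': "1 - 2 * (real (4 * B) * exp (- t)) \<le> measure (PiM {1..n} (\<lambda>_. S)) G \<and>
      (\<forall>x\<in>G. \<forall>A\<in>\<D>. \<bar>(\<Sum>i=1..n. indicator A (x i)) - real n * measure S A\<bar>
         \<le> \<theta> * (real n * measure S A) + 3 * t / \<theta>)"
    using uniform by (rule bexE)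
  note dev = G'[THEN conjunct2, rule_format]
  have "exp t = 8 * real B * exp \<xi>" using B by (simp add: t_def exp_add)
  then have "2 * (real (4 * B) * exp (- t)) = exp (- \<xi>)"
    using B by (simp add: exp_minus)
  then have G_prob: "1 - exp (- \<xi>) \<le> measure (PiM {1..n} (\<lambda>_. S)) G"
    using G' by simp
  define L where "L = ln (2 * exp 1 * real n / real (min V n))"
  define R where "R = 144 * a\<^sub>2 / real n * (450000 * a\<^sub>2^2 * real V * L + 1 + \<xi>)"
  have loss: "tv_dist S (Phat \<omega>) \<le> 14 * I + R"
    if \<omega>: "\<omega> \<in> space \<Omega>" "(\<lambda>i\<in>{1..n}. X i \<omega>) \<in> G" for \<omega>
  proof -
    obtain p where p: "p \<in> \<M>" "Phat \<omega> = prob_of \<mu> p"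
      "tv_stat \<mu> \<M> n (\<lambda>i. X i \<omega>) p \<le> (INF p'\<in>\<M>. tv_stat \<mu> \<M> n (\<lambda>i. X i \<omega>) p') + \<epsilon>"
      using est(2)[OF \<omega>(1)] by blast
    have "X i \<in> measurable \<Omega> \<mu>" if "i \<in> {1..n}" for i
      using assms(8) that unfolding \<Omega>.indep_vars_def by blast
    then have Xsp: "X i \<omega> \<in> space \<mu>" if "i \<in> {1..n}" for i
      using that \<omega>(1) by (meson measurable_space)
    have devX: "\<bar>(\<Sum>i=1..n. indicator A (X i \<omega>)) - real n * measure S A\<bar>
         \<le> \<theta> * (real n * measure S A) + 3 * t / \<theta>" if "A \<in> \<D>" for A
      using dev[OF \<omega>(2) that] by simp
    have "0 \<le> 3 * t / \<theta>"
      using B \<theta> \<open>\<xi> > 0\<close> by (simp add: t_def)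
    have "\<bar>(\<Sum>i=1..n. tv_test \<mu> r q (X i \<omega>)) - real n * tv_test_mean \<mu> S r q\<bar>
      \<le> 1/4 * (real n * (tv_dist S (prob_of \<mu> r) + tv_dist S (prob_of \<mu> q))) + 3 * t / \<theta>"
      if q: "q \<in> \<M>" for q
    \<comment> \<open>The classes in the dimension hypothesis leave out \<open>q = r\<close>, where the test vanishes.\<close>
    proof (cases "q = r")
      case True
      have "0 \<le> tv_dist S (prob_of \<mu> r)"
        using S r(1) \<M> by (intro tv_dist_nonneg prob_space_prob_of) auto
      then show ?thesis
        using \<open>0 \<le> 3 * t / \<theta>\<close> by (simp add: True tv_test_def tv_test_mean_def)
    next
      case False
      then have "{gt_set \<mu> q r, gt_set \<mu> r q, space \<mu> - gt_set \<mu> q r, space \<mu> - gt_set \<mu> r q} \<subseteq> \<D>"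
        using q by (auto simp: \<D>_def \<C>\<^sub>1_def \<C>\<^sub>2_def)
      then have "\<bar>(\<Sum>i=1..n. tv_test \<mu> r q (X i \<omega>)) - real n * tv_test_mean \<mu> S r q\<bar>
        \<le> \<theta> * (1 + a\<^sub>2') * (real n * (tv_dist S (prob_of \<mu> r) + tv_dist S (prob_of \<mu> q))) + 3 * t / \<theta>"
        using q r(1) \<M> \<theta>(1) by (intro sum_tv_test_deviation_le S assms(12) assms(13) Xsp devX) auto
      also have "\<theta> * (1 + a\<^sub>2') = 1/4"
        using a2 \<open>a\<^sub>2 = 1 + a\<^sub>2'\<close> by (simp add: \<theta>_def)
      finally show ?thesis .
    qed
    from tv_estimator_loss_le[OF S \<M> r(1) p(1) \<open>n \<ge> 1\<close> this p(3)]
    have "tv_dist S (Phat \<omega>) \<le> 13 * tv_dist S (prob_of \<mu> r) + (8 * (3 * t / \<theta>) + 4 * \<epsilon>) / real n"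
      by (simp add: p(2))
    also have "\<dots> \<le> 13 * (I + 1 / real n) + (8 * (3 * t / \<theta>) + 4 * \<epsilon>) / real n"
      using r(2) by simp
    also have "\<dots> = 13 * I + (13 + 8 * (12 * a\<^sub>2 * (ln 8 + ln (real B) + \<xi>)) + 4 * \<epsilon>) / real n"
      using B by (simp add: \<theta>_def t_def ln_mult add_divide_distrib algebra_simps)
    also have "\<dots> \<le> 14 * I + R"
    proof -
      have "exp 1 \<le> 2 * exp 1 * real n / real (min V n)"
        using \<open>n \<ge> 1\<close> \<open>V \<ge> 1\<close> by (simp add: field_simps)
      then have "ln (exp 1) \<le> L" unfolding L_def by (rule ln_mono) simp
      then have "1 \<le> L" by simp
      moreover have "ln (real B) \<le> real V * L"
        unfolding B_def L_def using assms by (intro ln_sum_binomial_le) auto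
      ultimately have "13 + 8 * (12 * a\<^sub>2 * (ln 8 + ln (real B) + \<xi>)) + 4 * \<epsilon>
          \<le> 144 * a\<^sub>2 * (450000 * a\<^sub>2^2 * real V * L + 1 + \<xi>)"
        using a2 assms by (intro remainder_le) auto
      then have "(13 + 8 * (12 * a\<^sub>2 * (ln 8 + ln (real B) + \<xi>)) + 4 * \<epsilon>) / real n
          \<le> 144 * a\<^sub>2 * (450000 * a\<^sub>2^2 * real V * L + 1 + \<xi>) / real n"
        by (rule divide_right_mono) simp
      then show ?thesis using near(1) by (simp add: R_def)
    qed
    finally show ?thesis .
  qed
  note sample = measure_iid_sample[OF assms(7,4) S(2) assms(8) assms(9)[folded S_def] G]
  have "measure \<Omega> {\<omega> \<in> space \<Omega>. (\<lambda>i\<in>{1..n}. X i \<omega>) \<in> G}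
      \<le> measure \<Omega> {\<omega> \<in> space \<Omega>. tv_dist S (Phat \<omega>) \<le> 14 * I + R}"
  proof (rule \<Omega>.finite_measure_mono)
    show "{\<omega> \<in> space \<Omega>. (\<lambda>i\<in>{1..n}. X i \<omega>) \<in> G}
        \<subseteq> {\<omega> \<in> space \<Omega>. tv_dist S (Phat \<omega>) \<le> 14 * I + R}"
      using loss by auto
    have "(\<lambda>\<omega>. tv_dist S (Phat \<omega>)) \<in> borel_measurable \<Omega>"
      using est(1) by (rule measurable_compose) simp
    then show "{\<omega> \<in> space \<Omega>. tv_dist S (Phat \<omega>) \<le> 14 * I + R} \<in> sets \<Omega>"
      by measurable
  qed
  then show ?thesis
    using sample(2) G_prob unfolding I_def R_def L_def S_def by simp
qed

end
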